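(* Let $G=\langle s_1,\dots,s_r\rangle$ be a free group or free semigroup (with identity) of rank $r$ and let $G\curvearrowright^T(X,\mathcal B,\mu)$ be a measure-preserving action. If $\alpha$ and $\beta$ are partitions of $X$ with $H(\alpha)+H(\beta)<\infty$, then $$f(T,\alpha\vee\beta)=f(T,\alpha)+f(T,\beta\,|\,\alpha^G).$$
   Context: $G=\langle s_1,\dots,s_r\rangle$ is either a free group or a free semigroup with identity $e$ on the generators $s_1,\dots,s_r$. Put $S=\{s_1^{\pm1},\dots,s_r^{\pm1}\}$ in the group case and $S=\{s_1,\dots,s_r\}$ in the semigroup case; $B(e,n)\subset G$ is the ball of radius $n$ about $e$ for the word metric of $S$. $G\curvearrowright^T(X,\mathcal B,\mu)$ means that $(X,\mathcal B,\mu)$ is a standard probability space and $g\mapsto T_g$ is a homomorphism from $G$ to the semigroup of measure-preserving transformations of $X$ ($\mu(T_g^{-1}E)=\mu(E)$ for all $g\in G$, $E\in\mathcal B$). Partitions are measurable and finite or countably infinite. $\alpha\vee\beta=\{A\cap B: A\in\alpha,B\in\beta\}$. $H(\alpha)=-\sum_{A\in\alpha}\mu(A)\log\mu(A)$. For a sub-$\sigma$-algebra $\mathcal F\subset\mathcal B$, $H(\alpha|\mathcal F)=\int_X -\log\big(\mu(A_x|\mathcal F)(x)\big)\,d\mu(x)$, where $A_x$ is the atom of $\alpha$ containing $x$ and $\mu(A|\mathcal F)$ is the conditional expectation of $\chi_A$. For finite $Q\subset G$, $\alpha^Q=\bigvee_{q\in Q}T_q^{-1}\alpha$, and $\alpha^n=\alpha^{B(e,n)}$.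 $\alpha^G$ is the smallest $G$-invariant $\sigma$-algebra containing $\alpha$, where $\mathcal F$ is $G$-invariant if $T_g^{-1}A\in\mathcal F$ for all $A\in\mathcal F$, $g\in G$. Define $$F(T,\alpha)=(1-2r)H(\alpha)+\sum_{i=1}^rH(\alpha\vee T_{s_i}^{-1}\alpha),\qquad f(T,\alpha)=\inf_{n>0}F(T,\alpha^n),$$ and for a $G$-invariant sub-$\sigma$-algebra $\mathcal F$, $$F(T,\alpha|\mathcal F)=(1-2r)H(\alpha|\mathcal F)+\sum_{i=1}^rH(\alpha\vee T_{s_i}^{-1}\alpha|\mathcal F),\qquad f(T,\alpha|\mathcal F)=\inf_{n>0}F(T,\alpha^n|\mathcal F).$$ (The infima may be $-\infty$.) *)

theory Defs
  imports "HOL-Probability.Probability" "HOL-Algebra.Group"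
begin

section \<open>Free groups and free monoids on a finite family of generators\<close>

(* A letter (i, True) stands for s i and (i, False) for its inverse. *)
definition letter :: "('g, 'm) monoid_scheme \<Rightarrow> (nat \<Rightarrow> 'g) \<Rightarrow> nat \<times> bool \<Rightarrow> 'g" where
  "letter G s = (\<lambda>(i, b). if b then s i else inv\<^bsub>G\<^esub> (s i))"

definition reduced_word :: "(nat \<times> bool) list \<Rightarrow> bool" where
  "reduced_word w \<longleftrightarrow> successively (\<lambda>a b. \<not> (fst a = fst b \<and> snd a \<noteq> snd b)) w"

(* Every element is the value of exactly one reduced word in s 1, ..., s r and their inverses. *)
definition free_group_on :: "('g, 'm) monoid_scheme \<Rightarrow> nat \<Rightarrow> (nat \<Rightarrow> 'g) \<Rightarrow> bool" where
  "free_group_on G r s \<longleftrightarrow> group G \<and> s ` {1..r} \<subseteq> carrier G \<and>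
     bij_betw (\<lambda>w. foldr (\<otimes>\<^bsub>G\<^esub>) (map (letter G s) w) \<one>\<^bsub>G\<^esub>)
       {w \<in> lists ({1..r} \<times> UNIV). reduced_word w} (carrier G)"

(* The free semigroup with identity. *)
definition free_monoid_on :: "('g, 'm) monoid_scheme \<Rightarrow> nat \<Rightarrow> (nat \<Rightarrow> 'g) \<Rightarrow> bool" where
  "free_monoid_on G r s \<longleftrightarrow> monoid G \<and> s ` {1..r} \<subseteq> carrier G \<and>
     bij_betw (\<lambda>w. foldr (\<otimes>\<^bsub>G\<^esub>) (map s w) \<one>\<^bsub>G\<^esub>) (lists {1..r}) (carrier G)"

definition word_length :: "('g, 'm) monoid_scheme \<Rightarrow> 'g set \<Rightarrow> 'g \<Rightarrow> nat" where
  "word_length G S g = (LEAST n. \<exists>w \<in> lists S. length w = n \<and> foldr (\<otimes>\<^bsub>G\<^esub>) w \<one>\<^bsub>G\<^esub> = g)"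

(* Used only when S generates G as a monoid, so that word_length is a genuine minimum. *)
definition word_ball :: "('g, 'm) monoid_scheme \<Rightarrow> 'g set \<Rightarrow> nat \<Rightarrow> 'g set" where
  "word_ball G S n = {g \<in> carrier G. word_length G S g \<le> n}"


section \<open>Measure-preserving actions on standard probability spaces\<close>

definition standard_borel_space :: "'a measure \<Rightarrow> bool" where
  "standard_borel_space N \<longleftrightarrow>
     (\<exists>X. completely_metrizable_space X \<and> second_countable X \<and> topspace X = space N \<and>
          sets N = sigma_sets (space N) {U. openin X U})"

(* Both usual conventions are covered: a Borel probability measure, or its completion. *)
definition standard_prob_space :: "'a measure \<Rightarrow> bool" where
  "standard_prob_space M \<longleftrightarrow>
     (\<exists>N. prob_space N \<and> standard_borel_space N \<and> (M = N \<or> M = completion N))"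

definition measure_preserving_map :: "'a measure \<Rightarrow> ('a \<Rightarrow> 'a) \<Rightarrow> bool" where
  "measure_preserving_map M t \<longleftrightarrow> t \<in> measurable M M \<and>
     (\<forall>E \<in> sets M. emeasure M (t -` E \<inter> space M) = emeasure M E)"

definition mp_action :: "('g, 'm) monoid_scheme \<Rightarrow> 'a measure \<Rightarrow> ('g \<Rightarrow> 'a \<Rightarrow> 'a) \<Rightarrow> bool" where
  "mp_action G M T \<longleftrightarrow> standard_prob_space M \<and>
     (\<forall>g \<in> carrier G. measure_preserving_map M (T g)) \<and>
     (\<forall>x \<in> space M. T \<one>\<^bsub>G\<^esub> x = x) \<and>
     (\<forall>g \<in> carrier G. \<forall>h \<in> carrier G. \<forall>x \<in> space M. T (g \<otimes>\<^bsub>G\<^esub> h) x = T g (T h x))"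


section \<open>Partitions\<close>

(* The empty cell is tolerated (it does not contribute to any entropy), so that the set
   {A \<inter> B | A \<in> \<alpha>, B \<in> \<beta>} is again a partition. *)
definition meas_partition :: "'a measure \<Rightarrow> 'a set set \<Rightarrow> bool" where
  "meas_partition M \<alpha> \<longleftrightarrow> countable \<alpha> \<and> \<alpha> \<subseteq> sets M \<and> disjoint \<alpha> \<and> \<Union>\<alpha> = space M"

definition pjoin :: "'a set set \<Rightarrow> 'a set set \<Rightarrow> 'a set set" where
  "pjoin \<alpha> \<beta> = {A \<inter> B | A B. A \<in> \<alpha> \<and> B \<in> \<beta>}"

definition pullback :: "'a measure \<Rightarrow> ('a \<Rightarrow> 'a) \<Rightarrow> 'a set set \<Rightarrow> 'a set set" where
  "pullback M t \<alpha> = (\<lambda>A. t -` A \<inter> space M) ` \<alpha>"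

(* The partition \<alpha>^Q, the join of the partitions T_q^{-1} \<alpha> over q \<in> Q. *)
definition join_over :: "'a measure \<Rightarrow> ('g \<Rightarrow> 'a \<Rightarrow> 'a) \<Rightarrow> 'g set \<Rightarrow> 'a set set \<Rightarrow> 'a set set" where
  "join_over M T Q \<alpha> =
     {space M \<inter> (\<Inter>q\<in>Q. C q) | C. \<forall>q\<in>Q. C q \<in> pullback M (T q) \<alpha>}"

(* Invariance under the whole semigroup, in the sense T_g^{-1} A \<in> \<Sigma> for A \<in> \<Sigma>. *)
definition invariant_sets ::
    "('g, 'm) monoid_scheme \<Rightarrow> 'a measure \<Rightarrow> ('g \<Rightarrow> 'a \<Rightarrow> 'a) \<Rightarrow> 'a set set \<Rightarrow> bool" where
  "invariant_sets G M T \<Sigma> \<longleftrightarrow> (\<forall>A\<in>\<Sigma>. \<forall>g\<in>carrier G. T g -` A \<inter> space M \<in> \<Sigma>)"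

(* \<alpha>^G. Following HOL-Probability, a sub-sigma-algebra is presented as a measure structure of
   which only the space and the measurable sets matter. *)
definition inv_algebra ::
    "('g, 'm) monoid_scheme \<Rightarrow> 'a measure \<Rightarrow> ('g \<Rightarrow> 'a \<Rightarrow> 'a) \<Rightarrow> 'a set set \<Rightarrow> 'a measure" where
  "inv_algebra G M T \<alpha> = sigma (space M)
     (\<Inter>{\<Sigma>. sigma_algebra (space M) \<Sigma> \<and> \<alpha> \<subseteq> \<Sigma> \<and> invariant_sets G M T \<Sigma>})"

(* The generating family above is already a sigma-algebra, so sigma adds no sets. *)
lemma sets_inv_algebra:
  assumes "\<alpha> \<subseteq> Pow (space M)"
  shows "sets (inv_algebra G M T \<alpha>) =
     \<Inter>{\<Sigma>. sigma_algebra (space M) \<Sigma> \<and> \<alpha> \<subseteq> \<Sigma> \<and> invariant_sets G M T \<Sigma>}" (is "_ = \<Inter>?F")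
proof -
  have "Pow (space M) \<in> ?F"
    using assms by (auto simp: invariant_sets_def sigma_algebra_Pow)
  then have ne: "?F \<noteq> {}" and sub: "\<Inter>?F \<subseteq> Pow (space M)" by blast+
  have "sigma_sets (space M) (\<Inter>?F) \<subseteq> \<Sigma>" if "\<Sigma> \<in> ?F" for \<Sigma>
    using that by (intro sigma_algebra.sigma_sets_subset) auto
  then have "sigma_sets (space M) (\<Inter>?F) = \<Inter>?F" by blast
  then show ?thesis using sub by (simp add: inv_algebra_def)
qed

lemma subalgebra_inv_algebra:
  assumes "mp_action G M T" "meas_partition M \<alpha>"
  shows "subalgebra M (inv_algebra G M T \<alpha>)"
proof -
  have "sets M \<in> {\<Sigma>. sigma_algebra (space M) \<Sigma> \<and> \<alpha> \<subseteq> \<Sigma> \<and> invariant_sets G M T \<Sigma>}"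
    using assms
    by (auto simp: mp_action_def meas_partition_def measure_preserving_map_def
        invariant_sets_def sets.sigma_algebra_axioms intro: measurable_sets)
  moreover have "\<alpha> \<subseteq> Pow (space M)"
    using assms(2) sets.space_closed by (auto simp: meas_partition_def)
  ultimately show ?thesis
    unfolding subalgebra_def by (subst sets_inv_algebra) (auto simp: inv_algebra_def space_measure_of_conv)
qed


section \<open>Entropy and the f-invariant\<close>

definition entropy :: "'a measure \<Rightarrow> 'a set set \<Rightarrow> ennreal" where
  "entropy M \<alpha> = (\<Sum>\<^sub>\<infinity>A\<in>\<alpha>. ennreal (- measure M A * ln (measure M A)))"

definition atom_of :: "'a set set \<Rightarrow> 'a \<Rightarrow> 'a set" where
  "atom_of \<alpha> x = (THE A. A \<in> \<alpha> \<and> x \<in> A)"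

(* Almost everywhere the conditional probability of the atom of x lies in (0, 1], so neither the
   convention ln 0 = 0 nor the truncation of negative reals by ennreal affects the integral. *)
definition cond_entropy :: "'a measure \<Rightarrow> 'a set set \<Rightarrow> 'a measure \<Rightarrow> ennreal" where
  "cond_entropy M \<alpha> F =
     (\<integral>\<^sup>+x. ennreal (- ln (real_cond_exp M F (indicator (atom_of \<alpha> x)) x)) \<partial>M)"

definition F_fun ::
    "'a measure \<Rightarrow> nat \<Rightarrow> (nat \<Rightarrow> 'g) \<Rightarrow> ('g \<Rightarrow> 'a \<Rightarrow> 'a) \<Rightarrow> 'a set set \<Rightarrow> ereal" where
  "F_fun M r s T \<alpha> = ereal (1 - 2 * real r) * enn2ereal (entropy M \<alpha>) +
     (\<Sum>i = 1..r. enn2ereal (entropy M (pjoin \<alpha> (pullback M (T (s i)) \<alpha>))))"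

definition f_inv ::
    "('g, 'm) monoid_scheme \<Rightarrow> 'g set \<Rightarrow> 'a measure \<Rightarrow> nat \<Rightarrow> (nat \<Rightarrow> 'g) \<Rightarrow>
     ('g \<Rightarrow> 'a \<Rightarrow> 'a) \<Rightarrow> 'a set set \<Rightarrow> ereal" where
  "f_inv G S M r s T \<alpha> = (INF n\<in>{0<..}. F_fun M r s T (join_over M T (word_ball G S n) \<alpha>))"

definition F_cond ::
    "'a measure \<Rightarrow> nat \<Rightarrow> (nat \<Rightarrow> 'g) \<Rightarrow> ('g \<Rightarrow> 'a \<Rightarrow> 'a) \<Rightarrow> 'a set set \<Rightarrow> 'a measure \<Rightarrow> ereal" where
  "F_cond M r s T \<alpha> F = ereal (1 - 2 * real r) * enn2ereal (cond_entropy M \<alpha> F) +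
     (\<Sum>i = 1..r. enn2ereal (cond_entropy M (pjoin \<alpha> (pullback M (T (s i)) \<alpha>)) F))"

definition f_cond ::
    "('g, 'm) monoid_scheme \<Rightarrow> 'g set \<Rightarrow> 'a measure \<Rightarrow> nat \<Rightarrow> (nat \<Rightarrow> 'g) \<Rightarrow>
     ('g \<Rightarrow> 'a \<Rightarrow> 'a) \<Rightarrow> 'a set set \<Rightarrow> 'a measure \<Rightarrow> ereal" where
  "f_cond G S M r s T \<alpha> F = (INF n\<in>{0<..}. F_cond M r s T (join_over M T (word_ball G S n) \<alpha>) F)"

end

theory Submission
  imports Defs "HOL-Real_Asymp.Real_Asymp"
begin

text \<open>
  Why the formula holds. Write \<open>P\<^sup>n\<close> for the join of \<open>P\<close> over the ball of radius \<open>n\<close> (\<open>ball_join P n\<close>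
  below) and \<open>P \<or> Q\<close> for the join. Since \<open>(P \<or> Q)\<^sup>n\<close> has the same nonempty cells as \<open>P\<^sup>n \<or> Q\<^sup>n\<close>, the left-hand
  side is the infimum of the diagonal values \<open>F (P\<^sup>n \<or> Q\<^sup>n)\<close>.

  The functional \<open>F\<close> decreases under splittings: if \<open>X\<close> is finer than \<open>Y\<close> and \<open>t\<close> is one of the
  letters in \<open>S\<close>, then replacing \<open>X\<close> by its join with the \<open>t\<close>-preimage of \<open>Y\<close> does not increase
  \<open>F\<close> (\<open>F_real_splitting_le\<close>). This is where the coefficient \<open>1 - 2 r\<close> comes from, and it follows from
  strong subadditivity and from the invariance of entropy under the action. Passing from \<open>P\<^sup>n\<close> to the next larger ball is a chain of such splittings, also in
  the presence of another partition. Hence \<open>F (P\<^sup>n \<or> Q\<^sup>m)\<close> decreases in \<open>n\<close> and in \<open>m\<close> separately, and the diagonal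
  infimum may be taken in two steps: first over \<open>n\<close>, for fixed \<open>m\<close>, then over \<open>m\<close>.

  For fixed \<open>m\<close>, \<open>F (P\<^sup>n \<or> Q\<^sup>m)\<close> is \<open>F (P\<^sup>n)\<close> plus the analogous combination of conditional entropies of
  \<open>Q\<^sup>m\<close> given \<open>P\<^sup>n\<close> and of \<open>Q\<^sup>m\<close> joined with its shifts, given \<open>P\<^sup>n\<close> joined with its shifts. The first term tends to
  its infimum. The conditioning partitions increase to the invariant algebra generated by \<open>P\<close>, so the
  second part tends to the conditional \<open>F\<close> of \<open>Q\<^sup>m\<close> given that algebra
  (\<open>F_real_increment_convergence\<close>); the limit is finite, so it may be added to an infimum that is possibly \<open>- \<infinity>\<close>.
  Taking the infimum over \<open>m\<close> gives the formula (\<open>INF_diagonal_eq_sum\<close>, \<open>f_inv_pjoin\<close>).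

  The analytic input is the continuity of conditional entropy along an increasing sequence of
  \<open>\<sigma>\<close>-algebras (\<open>cond_entropy_convergence\<close>). It is deduced from convergence of conditional expectations in
  \<open>L\<^sup>1\<close>, proved by a density argument, from uniform continuity of \<open>x \<mapsto> x * ln x\<close> on the unit interval,
  and from dominated convergence for the sum over the cells.
\<close>

section \<open>Cells of a partition\<close>

lemma atom_of_eq:
  assumes "meas_partition M P" "A \<in> P" "x \<in> A"
  shows "atom_of P x = A"
  unfolding atom_of_def
proof (rule the_equality)
  fix B assume "B \<in> P \<and> x \<in> B"
  then show "B = A"
    using assms by (auto simp: meas_partition_def disjoint_def)
qed (use assms in auto)

lemma atom_of_in:
  assumes "meas_partition M P" "x \<in> space M"
  shows "atom_of P x \<in> P" "x \<in> atom_of P x"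
proof -
  obtain A where "A \<in> P" "x \<in> A"
    using assms by (auto simp: meas_partition_def)
  with atom_of_eq[OF assms(1)] show "atom_of P x \<in> P" "x \<in> atom_of P x" by auto
qed

lemma meas_partition_cell:
  assumes "meas_partition M P" "A \<in> P"
  shows "A \<in> sets M" "A \<subseteq> space M"
  using assms sets.sets_into_space by (auto simp: meas_partition_def)

lemma atom_of_subset_space:
  assumes "meas_partition M P" "x \<in> space M"
  shows "atom_of P x \<subseteq> space M"
  by (rule meas_partition_cell(2)[OF assms(1) atom_of_in(1)[OF assms]])

lemma meas_partition_pjoin:
  assumes "meas_partition M P" "meas_partition M Q"
  shows "meas_partition M (pjoin P Q)"
  unfolding meas_partition_def
proof (intro conjI)
  have eq: "pjoin P Q = (\<lambda>(A, B). A \<inter> B) ` (P \<times> Q)"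
    by (auto simp: pjoin_def)
  show "countable (pjoin P Q)"
    unfolding eq using assms by (auto simp: meas_partition_def)
  show "pjoin P Q \<subseteq> sets M"
    using assms by (auto simp: pjoin_def meas_partition_def)
  show "disjoint (pjoin P Q)"
    using assms unfolding meas_partition_def disjoint_def pjoin_def by blast
  show "\<Union> (pjoin P Q) = space M"
    using assms unfolding meas_partition_def pjoin_def by blast
qed

lemma atom_of_pjoin:
  assumes "meas_partition M P" "meas_partition M Q" "x \<in> space M"
  shows "atom_of (pjoin P Q) x = atom_of P x \<inter> atom_of Q x"
  by (rule atom_of_eq[OF meas_partition_pjoin[OF assms(1,2)]])
    (use atom_of_in[OF assms(1,3)] atom_of_in[OF assms(2,3)] in \<open>auto simp: pjoin_def\<close>)

lemma meas_partition_pullback: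
  assumes "meas_partition M P" and t: "t \<in> measurable M M"
  shows "meas_partition M (pullback M t P)"
  unfolding meas_partition_def
proof (intro conjI)
  show "countable (pullback M t P)" "pullback M t P \<subseteq> sets M"
    using assms by (auto simp: pullback_def meas_partition_def)
  show "disjoint (pullback M t P)"
  proof (rule disjointI)
    fix A B assume "A \<in> pullback M t P" "B \<in> pullback M t P" "A \<noteq> B"
    then obtain A' B' where "A' \<in> P" "A = t -` A' \<inter> space M" "B' \<in> P" "B = t -` B' \<inter> space M" "A' \<noteq> B'"
      by (auto simp: pullback_def)
    moreover from this have "A' \<inter> B' = {}"
      using assms(1) by (auto simp: meas_partition_def disjoint_def)
    ultimately show "A \<inter> B = {}" by auto
  qed
  have "\<Union> (pullback M t P) = t -` \<Union>P \<inter> space M"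
    by (auto simp: pullback_def)
  then show "\<Union> (pullback M t P) = space M"
    using assms(1) measurable_space[OF t] by (auto simp: meas_partition_def)
qed

lemma atom_of_pullback:
  assumes "meas_partition M P" "t \<in> measurable M M" "x \<in> space M"
  shows "atom_of (pullback M t P) x = t -` atom_of P (t x) \<inter> space M"
  by (rule atom_of_eq[OF meas_partition_pullback[OF assms(1,2)]])
    (use atom_of_in[OF assms(1) measurable_space[OF assms(2,3)]] assms(3) in \<open>auto simp: pullback_def\<close>)

lemma meas_partition_trivial: "meas_partition M {space M}"
  by (auto simp: meas_partition_def disjoint_def)

text \<open>The relation is phrased through \<^const>\<open>atom_of\<close>, hence through the cells that contain a point,
  because forming joins may add or drop the empty cell: \<open>pjoin P P\<close> need not equal \<open>P\<close> as a set of
  sets. For the same reason partitions are compared below by the equality of their \<^const>\<open>atom_of\<close>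
  functions on the space; entropy and conditional entropy depend on nothing else.\<close>

definition refines :: "'a measure \<Rightarrow> 'a set set \<Rightarrow> 'a set set \<Rightarrow> bool" where
  "refines M P Q \<longleftrightarrow> (\<forall>x\<in>space M. atom_of P x \<subseteq> atom_of Q x)"

text \<open>Each cell of \<open>Q\<close> is the union of the countably many cells of \<open>P\<close> that it contains.\<close>

lemma refines_imp_sigma_sets:
  assumes P: "meas_partition M P" and Q: "meas_partition M Q" and ref: "refines M P Q"
  shows "Q \<subseteq> sigma_sets (space M) P"
proof
  fix A assume A: "A \<in> Q"
  have "A = \<Union> {C \<in> P. C \<subseteq> A}"
  proof
    show "A \<subseteq> \<Union> {C \<in> P. C \<subseteq> A}"
    proof
      fix x assume x: "x \<in> A"
      then have "x \<in> space M" using meas_partition_cell[OF Q A] by auto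
      moreover have "atom_of Q x = A" by (rule atom_of_eq[OF Q A x])
      ultimately have "atom_of P x \<in> {C \<in> P. C \<subseteq> A}"
        using ref atom_of_in[OF P] by (auto simp: refines_def)
      with \<open>x \<in> space M\<close> show "x \<in> \<Union> {C \<in> P. C \<subseteq> A}"
        using atom_of_in(2)[OF P] by blast
    qed
  qed auto
  moreover have "countable {C \<in> P. C \<subseteq> A}"
    using P by (auto simp: meas_partition_def intro: countable_subset)
  moreover have "C \<in> sigma_sets (space M) P" if "C \<in> {C \<in> P. C \<subseteq> A}" for C
    using that by auto
  ultimately show "A \<in> sigma_sets (space M) P"
    by (metis (mono_tags, lifting) sigma_sets_UNION)
qed

lemma measurable_atom_of:
  assumes "meas_partition M P"
  shows "atom_of P \<in> measurable M (count_space P)"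
proof -
  have "countable P" using assms by (simp add: meas_partition_def)
  moreover have "atom_of P -` {A} \<inter> space M = A" if "A \<in> P" for A
    using atom_of_eq[OF assms that] atom_of_in(2)[OF assms] meas_partition_cell(2)[OF assms that]
    by auto
  ultimately show ?thesis
    using assms atom_of_in[OF assms]
    by (auto simp: measurable_count_space_eq_countable meas_partition_def)
qed

lemma borel_measurable_atom_of:
  assumes "meas_partition M P" "\<And>A. A \<in> P \<Longrightarrow> g A \<in> borel_measurable M"
  shows "(\<lambda>x. g (atom_of P x) x) \<in> borel_measurable M"
proof -
  have "countable P" using assms(1) by (simp add: meas_partition_def)
  with assms(2) measurable_atom_of[OF assms(1)] show ?thesis
    by (rule measurable_compose_countable')
qed

text \<open>This turns integrals of functions that depend on the cell of the point, such as the one that defines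
  \<^const>\<open>cond_entropy\<close>, into sums over the cells.\<close>

lemma nn_integral_atom_of:
  fixes g :: "'a set \<Rightarrow> 'a \<Rightarrow> ennreal"
  assumes P: "meas_partition M P" and g: "\<And>A. A \<in> P \<Longrightarrow> g A \<in> borel_measurable M"
  shows "(\<integral>\<^sup>+x. g (atom_of P x) x \<partial>M) =
    (\<integral>\<^sup>+A. (\<integral>\<^sup>+x. g A x * indicator A x \<partial>M) \<partial>count_space P)"
proof -
  have "(\<integral>\<^sup>+A. (\<integral>\<^sup>+x. g A x * indicator A x \<partial>M) \<partial>count_space P)
      = (\<integral>\<^sup>+x. (\<integral>\<^sup>+A. g A x * indicator A x \<partial>count_space P) \<partial>M)"
  proof (rule nn_integral_count_space_nn_integral[symmetric])
    show "countable P" using P by (simp add: meas_partition_def)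
    fix A assume "A \<in> P"
    then have [measurable]: "g A \<in> borel_measurable M" "A \<in> sets M"
      using g meas_partition_cell(1)[OF P] by auto
    show "(\<lambda>x. g A x * indicator A x) \<in> borel_measurable M" by measurable
  qed
  also have "\<dots> = (\<integral>\<^sup>+x. g (atom_of P x) x \<partial>M)"
  proof (rule nn_integral_cong)
    fix x assume x: "x \<in> space M"
    have "(\<integral>\<^sup>+A. g A x * indicator A x \<partial>count_space P) = (\<Sum>A\<in>{atom_of P x}. g A x * indicator A x)"
    proof (rule nn_integral_count_space')
      fix A assume "A \<in> P" "A \<notin> {atom_of P x}"
      then have "x \<notin> A" using atom_of_eq[OF P] by blast
      then show "g A x * indicator A x = 0" by simp
    qed (use atom_of_in[OF P x] in simp_all)
    then show "(\<integral>\<^sup>+A. g A x * indicator A x \<partial>count_space P) = g (atom_of P x) x"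
      using atom_of_in[OF P x] by simp
  qed
  finally show ?thesis ..
qed

lemma infsum_ennreal_eq_nn_integral:
  fixes f :: "'i \<Rightarrow> ennreal"
  assumes "countable I"
  shows "(\<Sum>\<^sub>\<infinity>i\<in>I. f i) = (\<integral>\<^sup>+i. f i \<partial>count_space I)"
proof (cases "finite I")
  case True
  then show ?thesis by (simp add: nn_integral_count_space_finite)
next
  case False
  note bij = bij_betw_from_nat_into[OF assms False]
  have "(\<Sum>\<^sub>\<infinity>i\<in>I. f i) = (\<Sum>\<^sub>\<infinity>n. f (from_nat_into I n))"
    by (rule infsum_reindex_bij_betw[OF bij, symmetric])
  also have "\<dots> = (\<Sum>n. f (from_nat_into I n))"
    by (intro sums_unique has_sum_imp_sums has_sum_infsum nonneg_summable_on_complete) simp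
  also have "\<dots> = (\<integral>\<^sup>+i. f i \<partial>count_space I)"
    by (simp add: nn_integral_count_space_nat[symmetric] nn_integral_bij_count_space[OF bij])
  finally show ?thesis .
qed

section \<open>Entropy as the mean of the information function\<close>

context prob_space
begin

lemma entropy_eq_nn_integral_cells:
  assumes P: "meas_partition M P"
  shows "Defs.entropy M P = (\<integral>\<^sup>+A. ennreal (- prob A * ln (prob A)) \<partial>count_space P)"
  unfolding Defs.entropy_def
  by (rule infsum_ennreal_eq_nn_integral) (use P in \<open>simp add: meas_partition_def\<close>)

text \<open>The function \<open>x \<mapsto> - ln (prob (atom_of P x))\<close> is the information function of \<open>P\<close>. Its integral makes
  it visible that entropy depends on \<open>P\<close> only through \<open>atom_of P\<close>.\<close>

lemma entropy_eq_nn_integral: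
  assumes P: "meas_partition M P"
  shows "Defs.entropy M P = (\<integral>\<^sup>+x. ennreal (- ln (prob (atom_of P x))) \<partial>M)"
proof -
  have "(\<integral>\<^sup>+x. ennreal (- ln (prob (atom_of P x))) \<partial>M)
      = (\<integral>\<^sup>+A. (\<integral>\<^sup>+x. ennreal (- ln (prob A)) * indicator A x \<partial>M) \<partial>count_space P)"
    by (rule nn_integral_atom_of[OF P, where g="\<lambda>A x. ennreal (- ln (prob A))"]) auto
  also have "\<dots> = (\<integral>\<^sup>+A. ennreal (- prob A * ln (prob A)) \<partial>count_space P)"
  proof (rule nn_integral_cong)
    fix A assume "A \<in> space (count_space P)"
    then have "A \<in> events" using meas_partition_cell[OF P] by simp
    then have "(\<integral>\<^sup>+x. ennreal (- ln (prob A)) * indicator A x \<partial>M) = ennreal (- ln (prob A)) * ennreal (prob A)"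
      by (simp add: nn_integral_cmult_indicator emeasure_eq_measure)
    also have "\<dots> = ennreal (- ln (prob A) * prob A)"
      by (simp only: ennreal_mult''[OF measure_nonneg])
    finally show "(\<integral>\<^sup>+x. ennreal (- ln (prob A)) * indicator A x \<partial>M) = ennreal (- prob A * ln (prob A))"
      by (simp add: mult.commute)
  qed
  finally show ?thesis
    by (simp add: entropy_eq_nn_integral_cells[OF P])
qed

lemma AE_prob_atom_of_pos:
  assumes P: "meas_partition M P"
  shows "AE x in M. 0 < prob (atom_of P x)"
proof -
  have "AE x in M. \<forall>A\<in>{A\<in>P. prob A = 0}. x \<notin> A"
  proof (subst AE_ball_countable)
    show "countable {A \<in> P. prob A = 0}"
      using P by (auto simp: meas_partition_def intro: countable_subset)
    show "\<forall>A\<in>{A \<in> P. prob A = 0}. AE x in M. x \<notin> A"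
      using meas_partition_cell[OF P]
      by (auto intro!: AE_not_in simp: null_sets_def emeasure_eq_measure)
  qed
  with AE_space show ?thesis
  proof eventually_elim
    case (elim x)
    then show ?case
      using atom_of_in[OF P, of x] measure_nonneg[of M "atom_of P x"] by (auto simp: less_le)
  qed
qed

lemma entropy_cong:
  assumes "meas_partition M P" "meas_partition M Q" "\<And>x. x \<in> space M \<Longrightarrow> atom_of P x = atom_of Q x"
  shows "Defs.entropy M P = Defs.entropy M Q"
  using assms by (simp add: entropy_eq_nn_integral cong: nn_integral_cong)

lemma entropy_pullback:
  assumes P: "meas_partition M P" and t: "measure_preserving_map M t"
  shows "Defs.entropy M (pullback M t P) = Defs.entropy M P"
proof -
  have tm [measurable]: "t \<in> measurable M M"
    using t by (simp add: measure_preserving_map_def)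
  have dist: "distr M M t = M"
    by (rule measure_eqI) (use t in \<open>auto simp: emeasure_distr measure_preserving_map_def\<close>)
  have pr: "prob (t -` A \<inter> space M) = prob A" if "A \<in> events" for A
    using t that by (simp add: measure_preserving_map_def measure_def)
  define u where "u x = ennreal (- ln (prob (atom_of P x)))" for x
  have um: "u \<in> borel_measurable M"
    unfolding u_def by (rule borel_measurable_atom_of[OF P, where g="\<lambda>A x. ennreal (- ln (prob A))"]) simp
  have "Defs.entropy M (pullback M t P) = (\<integral>\<^sup>+x. u (t x) \<partial>M)"
    unfolding entropy_eq_nn_integral[OF meas_partition_pullback[OF P tm]] u_def
    by (rule nn_integral_cong)
      (simp add: atom_of_pullback[OF P tm] pr meas_partition_cell[OF P] atom_of_in[OF P] measurable_space[OF tm])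
  also have "\<dots> = (\<integral>\<^sup>+x. u x \<partial>M)"
    using nn_integral_distr[OF tm, of u] um dist by simp
  finally show ?thesis
    by (simp add: entropy_eq_nn_integral[OF P] u_def)
qed

section \<open>Conditioning on a countable partition\<close>

lemma subalgebra_sigma:
  assumes "Q \<subseteq> events"
  shows "subalgebra M (sigma (space M) Q)"
proof -
  have "Q \<subseteq> Pow (space M)" using assms sets.space_closed by blast
  with assms show ?thesis
    by (auto simp: subalgebra_def space_measure_of_conv sets.sigma_sets_subset)
qed

lemma sets_sigma_partition:
  assumes "meas_partition M Q"
  shows "sets (sigma (space M) Q) = sigma_sets (space M) Q"
  using meas_partition_cell(2)[OF assms] by (intro sets_measure_of) auto

lemma subalgebra_sigma_partition:
  assumes "meas_partition M Q"
  shows "subalgebra M (sigma (space M) Q)"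
  by (rule subalgebra_sigma) (use assms in \<open>simp add: meas_partition_def\<close>)

lemma subalgebra_sigma_refines:
  assumes "meas_partition M P" "meas_partition M Q" "refines M P Q"
  shows "subalgebra (sigma (space M) P) (sigma (space M) Q)"
proof -
  have "sigma_sets (space M) Q \<subseteq> sigma_sets (space M) P"
    using refines_imp_sigma_sets[OF assms] by (rule sigma_sets_mono)
  then show ?thesis
    by (simp add: subalgebra_def sets_sigma_partition assms space_measure_of_conv)
qed

text \<open>The sets that contain a given cell or miss it form a \<open>\<sigma>\<close>-algebra, so no set generated by \<open>Q\<close> cuts a
  cell of \<open>Q\<close>; apply this to the level sets of \<open>f\<close>.\<close>

lemma sigma_partition_constant_on_cells:
  assumes Q: "meas_partition M Q" and f: "f \<in> borel_measurable (sigma (space M) Q)"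
    and C: "C \<in> Q" "x \<in> C" "y \<in> C"
  shows "f y = (f x :: real)"
proof -
  have dich: "C \<subseteq> E \<or> C \<inter> E = {}" if "E \<in> sigma_sets (space M) Q" for E
    using that
  proof induction
    case (Basic A)
    then show ?case using Q C(1) by (auto simp: meas_partition_def disjoint_def)
  next
    case (Compl A)
    then show ?case using meas_partition_cell(2)[OF Q C(1)] by auto
  next
    case (Union A)
    then show ?case by (cases "\<exists>i. C \<subseteq> A i") auto
  qed auto
  have "f -` {f x} \<inter> space (sigma (space M) Q) \<in> sets (sigma (space M) Q)"
    by (rule measurable_sets[OF f]) auto
  then have "f -` {f x} \<inter> space M \<in> sigma_sets (space M) Q"
    by (simp add: sets_sigma_partition[OF Q] space_measure_of_conv)
  from dich[OF this] show ?thesis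
    using C meas_partition_cell(2)[OF Q C(1)] by auto
qed

lemma sigma_finite_subalgebra_of_subalgebra:
  assumes "subalgebra M F"
  shows "sigma_finite_subalgebra M F"
  using assms finite_measure_axioms
  by (intro finite_measure_subalgebra_is_sigma_finite)
    (simp add: finite_measure_subalgebra_def finite_measure_subalgebra_axioms_def)

text \<open>Being constant on \<open>C\<close>, the conditional expectation is determined there by its integral over \<open>C\<close>.
  The formula holds at every point of a cell of positive measure, not just almost everywhere.\<close>

lemma real_cond_exp_sigma_partition:
  assumes Q: "meas_partition M Q" and A: "A \<in> events" and C: "C \<in> Q" "x \<in> C" "prob C > 0"
  shows "real_cond_exp M (sigma (space M) Q) (indicator A) x = prob (A \<inter> C) / prob C"
proof -
  let ?F = "sigma (space M) Q"
  let ?f = "real_cond_exp M ?F (indicator A)"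
  interpret sigma_finite_subalgebra M ?F
    by (rule sigma_finite_subalgebra_of_subalgebra[OF subalgebra_sigma_partition[OF Q]])
  have Cs: "C \<in> events" "C \<in> sets ?F"
    using C(1) meas_partition_cell[OF Q] by (auto simp: sets_sigma_partition[OF Q])
  have int: "integrable M (indicator A :: 'a \<Rightarrow> real)"
    using A by (simp add: emeasure_eq_measure)
  have "prob (A \<inter> C) = (\<integral>x\<in>C. indicator A x \<partial>M)"
    using A Cs by (simp add: set_lebesgue_integral_def indicator_inter_arith[symmetric] Int_commute)
  also have "\<dots> = (\<integral>y\<in>C. ?f y \<partial>M)"
    by (rule real_cond_exp_intA[OF int Cs(2)])
  also have "\<dots> = (\<integral>y. ?f x * indicator C y \<partial>M)"
    unfolding set_lebesgue_integral_def
    by (rule Bochner_Integration.integral_cong)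
      (use sigma_partition_constant_on_cells[OF Q borel_measurable_cond_exp C(1,2)] in
        \<open>auto simp: indicator_def\<close>)
  also have "\<dots> = ?f x * prob C"
    using Cs by simp
  finally show ?thesis using C(3) by (simp add: field_simps)
qed

text \<open>The chain rule holds pointwise: the information of \<open>pjoin P Q\<close> at \<open>x\<close> is that of \<open>Q\<close> plus the
  conditional information of \<open>P\<close> given \<open>Q\<close>, unless \<open>x\<close> lies in one of the countably many null cells.\<close>

lemma entropy_chain_rule:
  assumes P: "meas_partition M P" and Q: "meas_partition M Q"
  shows "Defs.entropy M (pjoin P Q) = Defs.entropy M Q + cond_entropy M P (sigma (space M) Q)"
proof -
  let ?F = "sigma (space M) Q"
  note PQ = meas_partition_pjoin[OF P Q]
  define u where "u x = ennreal (- ln (prob (atom_of Q x)))" for x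
  define v where "v x = ennreal (- ln (real_cond_exp M ?F (indicator (atom_of P x)) x))" for x
  have [measurable]: "u \<in> borel_measurable M"
    unfolding u_def by (rule borel_measurable_atom_of[OF Q, where g="\<lambda>A x. ennreal (- ln (prob A))"]) simp
  have [measurable]: "v \<in> borel_measurable M"
    unfolding v_def by (rule borel_measurable_atom_of[OF P, where g="\<lambda>A x. ennreal (- ln (real_cond_exp M ?F (indicator A) x))"]) measurable
  have "AE x in M. ennreal (- ln (prob (atom_of (pjoin P Q) x))) = u x + v x"
    using AE_space AE_prob_atom_of_pos[OF PQ] AE_prob_atom_of_pos[OF Q]
  proof eventually_elim
    case (elim x)
    let ?A = "atom_of P x" and ?C = "atom_of Q x"
    have j: "atom_of (pjoin P Q) x = ?A \<inter> ?C" by (rule atom_of_pjoin[OF P Q elim(1)])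
    have A: "?A \<in> events" and C: "?C \<in> events"
      using meas_partition_cell[OF P] atom_of_in[OF P elim(1)] meas_partition_cell[OF Q] atom_of_in[OF Q elim(1)]
      by auto
    have ce: "real_cond_exp M ?F (indicator ?A) x = prob (?A \<inter> ?C) / prob ?C"
      by (rule real_cond_exp_sigma_partition[OF Q A]) (use atom_of_in[OF Q elim(1)] elim in auto)
    have pos: "0 < prob (?A \<inter> ?C)" "0 < prob ?C" using elim j by auto
    have le: "prob (?A \<inter> ?C) \<le> prob ?C" using A C by (intro finite_measure_mono) auto
    have "- ln (prob (?A \<inter> ?C)) = - ln (prob ?C) + - ln (prob (?A \<inter> ?C) / prob ?C)"
      using pos by (simp add: ln_div)
    moreover have "0 \<le> - ln (prob ?C)" "0 \<le> - ln (prob (?A \<inter> ?C) / prob ?C)"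
      using pos le by (auto simp: ln_le_zero_iff)
    ultimately show ?case
      by (simp add: u_def v_def ce j ennreal_plus[symmetric] del: ennreal_plus)
  qed
  then have "Defs.entropy M (pjoin P Q) = (\<integral>\<^sup>+x. u x + v x \<partial>M)"
    unfolding entropy_eq_nn_integral[OF PQ] by (rule nn_integral_cong_AE)
  also have "\<dots> = (\<integral>\<^sup>+x. u x \<partial>M) + (\<integral>\<^sup>+x. v x \<partial>M)"
    by (rule nn_integral_add) simp_all
  finally show ?thesis
    by (simp add: entropy_eq_nn_integral[OF Q] cond_entropy_def u_def v_def)
qed

section \<open>Conditional information of a single cell\<close>

lemma integrable_indicator_event:
  "A \<in> events \<Longrightarrow> integrable M (indicator A :: 'a \<Rightarrow> real)"
  by (simp add: emeasure_eq_measure)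

lemma real_cond_exp_indicator_bounds:
  assumes F: "subalgebra M F" and A: "A \<in> events"
  shows "AE x in M. 0 \<le> real_cond_exp M F (indicator A) x \<and> real_cond_exp M F (indicator A) x \<le> 1"
proof -
  interpret sigma_finite_subalgebra M F
    by (rule sigma_finite_subalgebra_of_subalgebra[OF F])
  have "AE x in M. real_cond_exp M F (indicator A) x \<ge> 0"
    by (rule real_cond_exp_ge_c[OF integrable_indicator_event[OF A]]) auto
  moreover have "AE x in M. real_cond_exp M F (indicator A) x \<le> 1"
    by (rule real_cond_exp_le_c[OF integrable_indicator_event[OF A]]) (auto simp: indicator_def)
  ultimately show ?thesis by eventually_elim auto
qed

text \<open>The defining property of conditional probability for all nonnegative test functions at once. It is
  needed for test functions such as \<open>- ln\<close> of a conditional probability, which need not be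
  integrable.\<close>

lemma nn_integral_times_cond_prob:
  assumes F: "subalgebra M F" and A: "A \<in> events" and g: "g \<in> borel_measurable F"
  shows "(\<integral>\<^sup>+x. g x * indicator A x \<partial>M) = (\<integral>\<^sup>+x. g x * ennreal (real_cond_exp M F (indicator A) x) \<partial>M)"
proof -
  let ?f = "real_cond_exp M F (indicator A)"
  interpret sigma_finite_subalgebra M F
    by (rule sigma_finite_subalgebra_of_subalgebra[OF F])
  have [measurable]: "A \<in> sets M" by (rule A)
  note int = integrable_indicator_event[OF A]
  note bd = real_cond_exp_indicator_bounds[OF F A]
  have "AE x in M. ennreal (?f x) = nn_cond_exp M F (\<lambda>x. ennreal (indicator A x)) x"
  proof (rule nn_cond_exp_charact)
    fix B assume B: "B \<in> sets F"
    then have [measurable]: "B \<in> sets M" using F by (auto simp: subalgebra_def)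
    have "(\<integral>\<^sup>+x\<in>B. ennreal (indicator A x) \<partial>M) = ennreal (\<integral>x\<in>B. indicator A x \<partial>M)"
    proof -
      have "(\<integral>\<^sup>+x\<in>B. ennreal (indicator A x) \<partial>M) = (\<integral>\<^sup>+x. indicator (A \<inter> B) x \<partial>M)"
        by (rule nn_integral_cong) (auto simp: indicator_def)
      moreover have "(\<integral>x\<in>B. indicator A x \<partial>M) = prob (A \<inter> B)"
        by (simp add: set_lebesgue_integral_def indicator_inter_arith[symmetric] Int_commute)
      ultimately show ?thesis by (simp add: emeasure_eq_measure)
    qed
    also have "\<dots> = ennreal (\<integral>x\<in>B. ?f x \<partial>M)"
      by (simp add: real_cond_exp_intA[OF int B])
    also have "\<dots> = (\<integral>\<^sup>+x\<in>B. ennreal (?f x) \<partial>M)"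
    proof -
      have i: "integrable M (\<lambda>x. indicator B x *\<^sub>R ?f x)"
        using real_cond_exp_int(1)[OF int] by (intro integrable_mult_indicator) auto
      have "AE x in M. 0 \<le> indicator B x *\<^sub>R ?f x"
        using bd by eventually_elim (auto simp: indicator_def)
      then have "ennreal (\<integral>x\<in>B. ?f x \<partial>M) = (\<integral>\<^sup>+x. ennreal (indicator B x *\<^sub>R ?f x) \<partial>M)"
        unfolding set_lebesgue_integral_def by (rule nn_integral_eq_integral[OF i, symmetric])
      also have "\<dots> = (\<integral>\<^sup>+x\<in>B. ennreal (?f x) \<partial>M)"
        by (rule nn_integral_cong) (auto simp: indicator_def)
      finally show ?thesis .
    qed
    finally show "(\<integral>\<^sup>+x\<in>B. ennreal (indicator A x) \<partial>M) = (\<integral>\<^sup>+x\<in>B. ennreal (?f x) \<partial>M)" .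
  qed auto
  then have "(\<integral>\<^sup>+x. g x * ennreal (?f x) \<partial>M) = (\<integral>\<^sup>+x. g x * nn_cond_exp M F (\<lambda>x. ennreal (indicator A x)) x \<partial>M)"
    by (intro nn_integral_cong_AE) auto
  also have "\<dots> = (\<integral>\<^sup>+x. g x * ennreal (indicator A x) \<partial>M)"
    by (rule nn_cond_exp_intg[OF g]) auto
  also have "\<dots> = (\<integral>\<^sup>+x. g x * indicator A x \<partial>M)"
    by (rule nn_integral_cong) (auto simp: indicator_def)
  finally show ?thesis ..
qed

text \<open>The contribution of one cell to \<^const>\<open>cond_entropy\<close>. Monotonicity and convergence in the
  \<open>\<sigma>\<close>-algebra are proved cell by cell and then summed.\<close>

definition cell_entropy :: "'a measure \<Rightarrow> 'a set \<Rightarrow> ennreal" where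
  "cell_entropy F A = (\<integral>\<^sup>+x. ennreal (- ln (real_cond_exp M F (indicator A) x)) * indicator A x \<partial>M)"

lemma cond_entropy_eq_cells:
  assumes P: "meas_partition M P"
  shows "cond_entropy M P F = (\<integral>\<^sup>+A. cell_entropy F A \<partial>count_space P)"
  unfolding cond_entropy_def cell_entropy_def
  by (rule nn_integral_atom_of[OF P, where g="\<lambda>A x. ennreal (- ln (real_cond_exp M F (indicator A) x))"])
    measurable

lemma cell_entropy_eq:
  assumes F: "subalgebra M F" and A: "A \<in> events"
  shows "cell_entropy F A =
    (\<integral>\<^sup>+x. ennreal (- real_cond_exp M F (indicator A) x * ln (real_cond_exp M F (indicator A) x)) \<partial>M)"
proof -
  let ?f = "real_cond_exp M F (indicator A)"
  have "cell_entropy F A = (\<integral>\<^sup>+x. ennreal (- ln (?f x)) * ennreal (?f x) \<partial>M)"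
    unfolding cell_entropy_def by (rule nn_integral_times_cond_prob[OF F A]) measurable
  also have "\<dots> = (\<integral>\<^sup>+x. ennreal (- ?f x * ln (?f x)) \<partial>M)"
  proof (rule nn_integral_cong_AE)
    show "AE x in M. ennreal (- ln (?f x)) * ennreal (?f x) = ennreal (- ?f x * ln (?f x))"
      using real_cond_exp_indicator_bounds[OF F A]
    proof eventually_elim
      case (elim x)
      then have "ennreal (- ln (?f x)) * ennreal (?f x) = ennreal (- ln (?f x) * ?f x)"
        by (simp only: ennreal_mult'')
      then show ?case by (simp add: mult.commute)
    qed
  qed
  finally show ?thesis .
qed

text \<open>The concave function \<open>b \<mapsto> - b * ln b\<close> lies below its tangent at \<open>a\<close>.\<close>

lemma entropy_tangent_line:
  fixes a b :: real
  assumes "0 \<le> b" "0 < a"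
  shows "- b * ln b + b \<le> b * (- ln a) + a"
proof (cases "b = 0")
  case False
  with assms have "b > 0" by simp
  have "ln (a / b) \<le> a / b - 1"
    using assms \<open>b > 0\<close> by (intro ln_le_minus_one) simp
  then have "b * (ln a - ln b) \<le> b * (a / b - 1)"
    using assms \<open>b > 0\<close> by (intro mult_left_mono) (simp_all add: ln_div)
  also have "\<dots> = a - b" using \<open>b > 0\<close> by (simp add: field_simps)
  finally show ?thesis by (simp add: algebra_simps)
qed (use assms in simp)

text \<open>This is Jensen's inequality for \<open>b \<mapsto> - b * ln b\<close>, obtained by integrating the tangent inequality
  at the coarser conditional probability \<open>k\<close>: the slope term \<open>- ln k\<close> is measurable for the coarser
  algebra \<open>K\<close>, so there the finer conditional probability \<open>f\<close> may be replaced by the indicator of \<open>A\<close>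
  and then by \<open>k\<close>. All terms are nonnegative, so infinite values do no harm.\<close>

lemma cell_entropy_antimono:
  assumes F: "subalgebra M F" and K: "subalgebra F K" and A: "A \<in> events"
  shows "cell_entropy F A \<le> cell_entropy K A"
proof -
  have MK: "subalgebra M K" using F K by (auto simp: subalgebra_def)
  let ?f = "real_cond_exp M F (indicator A)" and ?k = "real_cond_exp M K (indicator A)"
  have [measurable]: "A \<in> sets M" by (rule A)
  have kF [measurable]: "?k \<in> borel_measurable F"
    by (rule measurable_from_subalg[OF K borel_measurable_cond_exp])
  note bf = real_cond_exp_indicator_bounds[OF F A] and bk = real_cond_exp_indicator_bounds[OF MK A]
  \<comment> \<open>Where \<open>?k\<close> vanishes the tangent is vertical, but there \<open>?f\<close> vanishes too, almost everywhere.\<close>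
  let ?z = "\<lambda>x. indicator {x. ?k x \<le> 0} x :: ennreal"
  have "(\<integral>\<^sup>+x. ?z x * ennreal (?f x) \<partial>M) = (\<integral>\<^sup>+x. ?z x * indicator A x \<partial>M)"
  proof (rule nn_integral_times_cond_prob[OF F A, symmetric])
    show "?z \<in> borel_measurable F" by measurable
  qed
  also have "\<dots> = (\<integral>\<^sup>+x. ?z x * ennreal (?k x) \<partial>M)"
  proof (rule nn_integral_times_cond_prob[OF MK A])
    show "?z \<in> borel_measurable K" by measurable
  qed
  also have "\<dots> = (\<integral>\<^sup>+x. 0 \<partial>M)"
    by (rule nn_integral_cong) (auto simp: indicator_def ennreal_neg)
  finally have "(\<integral>\<^sup>+x. ?z x * ennreal (?f x) \<partial>M) = 0"
    by simp
  moreover have "(\<lambda>x. ?z x * ennreal (?f x)) \<in> borel_measurable M"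
    using measurable_from_subalg[OF F kF] by measurable
  ultimately have "AE x in M. ?z x * ennreal (?f x) = 0"
    by (simp only: nn_integral_0_iff_AE)
  then have "AE x in M. ennreal (- ?f x * ln (?f x)) + ennreal (?f x)
      \<le> ennreal (- ln (?k x)) * ennreal (?f x) + ennreal (?k x)"
    using bf bk
  proof eventually_elim
    case (elim x)
    show ?case
    proof (cases "?k x = 0")
      case True
      with elim have "?f x = 0" by (auto simp: ennreal_eq_0_iff)
      then show ?thesis by simp
    next
      case False
      with elim have k: "?k x > 0" by simp
      have 1: "0 \<le> - ?f x * ln (?f x)" "0 \<le> - ln (?k x)"
        using elim k by (cases "?f x = 0"; simp add: mult_nonneg_nonpos)+
      have "ennreal (- ?f x * ln (?f x) + ?f x) \<le> ennreal (?f x * (- ln (?k x)) + ?k x)"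
        by (intro ennreal_leI entropy_tangent_line) (use elim k in auto)
      moreover have "ennreal (- ?f x * ln (?f x) + ?f x) = ennreal (- ?f x * ln (?f x)) + ennreal (?f x)"
        by (rule ennreal_plus) (use 1 elim in auto)
      moreover have "ennreal (?f x * (- ln (?k x)) + ?k x) = ennreal (?f x * (- ln (?k x))) + ennreal (?k x)"
        by (rule ennreal_plus) (use 1 elim in \<open>auto simp: mult_nonneg_nonpos\<close>)
      moreover have "ennreal (?f x * (- ln (?k x))) = ennreal (- ln (?k x)) * ennreal (?f x)"
        using elim by (subst ennreal_mult') (auto simp: mult.commute)
      ultimately show ?thesis by (simp only:)
    qed
  qed
  then have "(\<integral>\<^sup>+x. ennreal (- ?f x * ln (?f x)) + ennreal (?f x) \<partial>M)
      \<le> (\<integral>\<^sup>+x. ennreal (- ln (?k x)) * ennreal (?f x) + ennreal (?k x) \<partial>M)"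
    by (rule nn_integral_mono_AE)
  moreover have "(\<integral>\<^sup>+x. ennreal (- ?f x * ln (?f x)) + ennreal (?f x) \<partial>M) = cell_entropy F A + emeasure M A"
    using nn_integral_times_cond_prob[OF F A, of "\<lambda>_. 1"]
    by (subst nn_integral_add) (simp_all add: cell_entropy_eq[OF F A])
  moreover have "(\<integral>\<^sup>+x. ennreal (- ln (?k x)) * ennreal (?f x) + ennreal (?k x) \<partial>M) = cell_entropy K A + emeasure M A"
  proof -
    have "(\<integral>\<^sup>+x. ennreal (- ln (?k x)) * ennreal (?f x) \<partial>M) = cell_entropy K A"
      unfolding cell_entropy_def by (rule nn_integral_times_cond_prob[OF F A, symmetric]) measurable
    then show ?thesis
      using nn_integral_times_cond_prob[OF MK A, of "\<lambda>_. 1"]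
      by (subst nn_integral_add) simp_all
  qed
  ultimately show ?thesis
    by (simp add: emeasure_eq_measure)
qed

lemma cond_entropy_antimono:
  assumes P: "meas_partition M P" and "subalgebra M F" "subalgebra F K"
  shows "cond_entropy M P F \<le> cond_entropy M P K"
  unfolding cond_entropy_eq_cells[OF P]
  by (rule nn_integral_mono) (use assms meas_partition_cell[OF P] in \<open>auto intro!: cell_entropy_antimono\<close>)

lemma cell_entropy_trivial:
  assumes A: "A \<in> events"
  shows "cell_entropy (sigma (space M) {space M}) A = ennreal (- prob A * ln (prob A))"
proof -
  have "cell_entropy (sigma (space M) {space M}) A = (\<integral>\<^sup>+x. ennreal (- prob A * ln (prob A)) \<partial>M)"
    unfolding cell_entropy_eq[OF subalgebra_sigma_partition[OF meas_partition_trivial] A]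
    using real_cond_exp_sigma_partition[OF meas_partition_trivial A, of "space M"] A
    by (intro nn_integral_cong) (simp add: prob_space)
  then show ?thesis by (simp add: emeasure_space_1)
qed

text \<open>Monotonicity against the trivial algebra. The right-hand side is summable over the cells of a partition
  of finite entropy, so it will serve as the dominating function.\<close>

lemma cell_entropy_le:
  assumes F: "subalgebra M F" and A: "A \<in> events"
  shows "cell_entropy F A \<le> ennreal (- prob A * ln (prob A))"
proof -
  have "sets (sigma (space M) {space M}) \<subseteq> sets F"
    using F by (auto simp: subalgebra_def sigma_sets_empty_eq sets_sigma_partition[OF meas_partition_trivial]
      intro: sets.sigma_sets_subset[THEN subsetD, rotated] dest!: sym[of "space F"])
  then have "subalgebra F (sigma (space M) {space M})"
    using F by (simp add: subalgebra_def space_measure_of_conv)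
  from cell_entropy_antimono[OF F this A] show ?thesis
    by (simp add: cell_entropy_trivial[OF A])
qed

lemma cond_entropy_le_entropy:
  assumes P: "meas_partition M P" and F: "subalgebra M F"
  shows "cond_entropy M P F \<le> Defs.entropy M P"
  unfolding cond_entropy_eq_cells[OF P] entropy_eq_nn_integral_cells[OF P]
proof (rule nn_integral_mono)
  fix A assume "A \<in> space (count_space P)"
  then show "cell_entropy F A \<le> ennreal (- prob A * ln (prob A))"
    using meas_partition_cell(1)[OF P] by (intro cell_entropy_le[OF F]) simp
qed

lemma entropy_pjoin_le:
  assumes P: "meas_partition M P" and Q: "meas_partition M Q"
  shows "Defs.entropy M (pjoin P Q) \<le> Defs.entropy M P + Defs.entropy M Q"
  using cond_entropy_le_entropy[OF P subalgebra_sigma_partition[OF Q]]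
  by (simp add: entropy_chain_rule[OF P Q] add.commute add_mono)

text \<open>Strong subadditivity: conditioning \<open>P\<close> on \<open>pjoin Q R\<close> instead of \<open>R\<close> cannot increase entropy. The
  additive form avoids subtraction of possibly infinite terms.\<close>

lemma entropy_submodular:
  assumes P: "meas_partition M P" and Q: "meas_partition M Q" and R: "meas_partition M R"
  shows "Defs.entropy M (pjoin P (pjoin Q R)) + Defs.entropy M R
    \<le> Defs.entropy M (pjoin P R) + Defs.entropy M (pjoin Q R)"
proof -
  note QR = meas_partition_pjoin[OF Q R]
  have "refines M (pjoin Q R) R"
    by (simp add: refines_def atom_of_pjoin[OF Q R])
  then have "cond_entropy M P (sigma (space M) (pjoin Q R)) \<le> cond_entropy M P (sigma (space M) R)"
    by (intro cond_entropy_antimono[OF P subalgebra_sigma_partition[OF QR]]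
        subalgebra_sigma_refines[OF QR R])
  then show ?thesis
    by (simp add: entropy_chain_rule[OF P QR] entropy_chain_rule[OF P R] add.commute add.left_commute
        add_left_mono)
qed

section \<open>Convergence of conditional expectations along a filtration\<close>

lemma L1_dist_triangle:
  fixes f g h :: "'a \<Rightarrow> real"
  assumes "integrable M f" "integrable M g" "integrable M h"
  shows "(\<integral>x. \<bar>f x - h x\<bar> \<partial>M) \<le> (\<integral>x. \<bar>f x - g x\<bar> \<partial>M) + (\<integral>x. \<bar>g x - h x\<bar> \<partial>M)"
proof -
  have "(\<integral>x. \<bar>f x - h x\<bar> \<partial>M) \<le> (\<integral>x. \<bar>f x - g x\<bar> + \<bar>g x - h x\<bar> \<partial>M)"
    using assms by (intro integral_mono) auto
  also have "\<dots> = (\<integral>x. \<bar>f x - g x\<bar> \<partial>M) + (\<integral>x. \<bar>g x - h x\<bar> \<partial>M)"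
    using assms by (intro Bochner_Integration.integral_add) auto
  finally show ?thesis .
qed

lemma real_cond_exp_L1_contraction:
  assumes F: "subalgebra M F" and f: "integrable M f" and g: "integrable M g"
  shows "(\<integral>x. \<bar>real_cond_exp M F f x - real_cond_exp M F g x\<bar> \<partial>M) \<le> (\<integral>x. \<bar>f x - g x\<bar> \<partial>M)"
proof -
  interpret sigma_finite_subalgebra M F
    by (rule sigma_finite_subalgebra_of_subalgebra[OF F])
  define h where "h = (\<lambda>x. f x - g x)"
  have h: "integrable M h" and ah: "integrable M (\<lambda>x. \<bar>h x\<bar>)" and mh: "integrable M (\<lambda>x. - \<bar>h x\<bar>)"
    using f g by (auto simp: h_def)
  have "AE x in M. real_cond_exp M F h x \<le> real_cond_exp M F (\<lambda>x. \<bar>h x\<bar>) x"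
    by (rule real_cond_exp_mono) (use h ah in auto)
  moreover have "AE x in M. real_cond_exp M F (\<lambda>x. - \<bar>h x\<bar>) x \<le> real_cond_exp M F h x"
    by (rule real_cond_exp_mono) (use h mh in auto)
  moreover have "AE x in M. real_cond_exp M F (\<lambda>x. - \<bar>h x\<bar>) x = - real_cond_exp M F (\<lambda>x. \<bar>h x\<bar>) x"
    using real_cond_exp_cmult[OF ah, of "-1"] by simp
  moreover have "AE x in M. real_cond_exp M F h x = real_cond_exp M F f x - real_cond_exp M F g x"
    unfolding h_def by (rule real_cond_exp_diff[OF f g])
  ultimately have "AE x in M. \<bar>real_cond_exp M F f x - real_cond_exp M F g x\<bar> \<le> real_cond_exp M F (\<lambda>x. \<bar>h x\<bar>) x"
    by eventually_elim auto
  then have "(\<integral>x. \<bar>real_cond_exp M F f x - real_cond_exp M F g x\<bar> \<partial>M) \<le> (\<integral>x. real_cond_exp M F (\<lambda>x. \<bar>h x\<bar>) x \<partial>M)"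
  proof (rule integral_mono_AE[rotated 2])
    show "integrable M (\<lambda>x. \<bar>real_cond_exp M F f x - real_cond_exp M F g x\<bar>)"
      by (intro Bochner_Integration.integrable_abs Bochner_Integration.integrable_diff real_cond_exp_int(1) f g)
  qed (rule real_cond_exp_int(1)[OF ah])
  also have "\<dots> = (\<integral>x. \<bar>f x - g x\<bar> \<partial>M)"
    using real_cond_exp_int(2)[OF ah] by (simp add: h_def)
  finally show ?thesis .
qed

text \<open>For an increasing sequence \<open>F\<close> these functions form an \<open>L\<^sup>1\<close>-closed linear space, because
  conditional expectations are contractions. It contains the indicators of the sets of each \<open>F n\<close>,
  hence by Dynkin's lemma those of the generated \<open>\<sigma>\<close>-algebra, hence all integrable functions measurable for
  it. This yields the convergence theorem in \<open>L\<^sup>1\<close>.\<close>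

definition L1_approximable :: "(nat \<Rightarrow> 'a measure) \<Rightarrow> ('a \<Rightarrow> real) \<Rightarrow> bool" where
  "L1_approximable F g \<longleftrightarrow> (\<lambda>n. \<integral>x. \<bar>real_cond_exp M (F n) g x - g x\<bar> \<partial>M) \<longlonglongrightarrow> 0"

context
  fixes F :: "nat \<Rightarrow> 'a measure"
  assumes F: "\<And>n. subalgebra M (F n)" and incF: "\<And>n. subalgebra (F (Suc n)) (F n)"
begin

lemma filtration_mono: "m \<le> n \<Longrightarrow> sets (F m) \<subseteq> sets (F n)"
  by (rule lift_Suc_mono_le[of "\<lambda>n. sets (F n)"]) (use incF in \<open>simp_all add: subalgebra_def\<close>)

lemma L1_approximable_lincomb:
  assumes f: "integrable M f" "L1_approximable F f" and g: "integrable M g" "L1_approximable F g"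
  shows "L1_approximable F (\<lambda>x. a * f x + b * g x)"
proof -
  let ?E = "\<lambda>n. real_cond_exp M (F n)"
  have bound: "(\<integral>x. \<bar>?E n (\<lambda>x. a * f x + b * g x) x - (a * f x + b * g x)\<bar> \<partial>M)
      \<le> \<bar>a\<bar> * (\<integral>x. \<bar>?E n f x - f x\<bar> \<partial>M) + \<bar>b\<bar> * (\<integral>x. \<bar>?E n g x - g x\<bar> \<partial>M)" for n
  proof -
    interpret sigma_finite_subalgebra M "F n"
      by (rule sigma_finite_subalgebra_of_subalgebra[OF F])
    have i: "integrable M (\<lambda>x. a * f x)" "integrable M (\<lambda>x. b * g x)" using f g by auto
    note I = real_cond_exp_int(1)[OF f(1)] real_cond_exp_int(1)[OF g(1)]
    have "AE x in M. ?E n (\<lambda>x. a * f x + b * g x) x = ?E n (\<lambda>x. a * f x) x + ?E n (\<lambda>x. b * g x) x"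
      by (rule real_cond_exp_add[OF i])
    with real_cond_exp_cmult[OF f(1), of a] real_cond_exp_cmult[OF g(1), of b]
    have "AE x in M. \<bar>?E n (\<lambda>x. a * f x + b * g x) x - (a * f x + b * g x)\<bar>
        \<le> \<bar>a\<bar> * \<bar>?E n f x - f x\<bar> + \<bar>b\<bar> * \<bar>?E n g x - g x\<bar>"
    proof eventually_elim
      case (elim x)
      have "a * ?E n f x + b * ?E n g x - (a * f x + b * g x) = a * (?E n f x - f x) + b * (?E n g x - g x)"
        by (simp add: algebra_simps)
      then show ?case
        using elim abs_triangle_ineq[of "a * (?E n f x - f x)" "b * (?E n g x - g x)"]
        by (simp add: abs_mult)
    qed
    then have "(\<integral>x. \<bar>?E n (\<lambda>x. a * f x + b * g x) x - (a * f x + b * g x)\<bar> \<partial>M)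
        \<le> (\<integral>x. \<bar>a\<bar> * \<bar>?E n f x - f x\<bar> + \<bar>b\<bar> * \<bar>?E n g x - g x\<bar> \<partial>M)"
    proof (rule integral_mono_AE[rotated 2])
      show "integrable M (\<lambda>x. \<bar>?E n (\<lambda>x. a * f x + b * g x) x - (a * f x + b * g x)\<bar>)"
        by (intro Bochner_Integration.integrable_abs Bochner_Integration.integrable_diff
            real_cond_exp_int(1) Bochner_Integration.integrable_add i)
      show "integrable M (\<lambda>x. \<bar>a\<bar> * \<bar>?E n f x - f x\<bar> + \<bar>b\<bar> * \<bar>?E n g x - g x\<bar>)"
        by (intro Bochner_Integration.integrable_add integrable_mult_right Bochner_Integration.integrable_abs
            Bochner_Integration.integrable_diff I f(1) g(1))
    qed
    also have "\<dots> = \<bar>a\<bar> * (\<integral>x. \<bar>?E n f x - f x\<bar> \<partial>M) + \<bar>b\<bar> * (\<integral>x. \<bar>?E n g x - g x\<bar> \<partial>M)"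
      using I f g by (subst Bochner_Integration.integral_add) auto
    finally show ?thesis .
  qed
  have "(\<lambda>n. \<bar>a\<bar> * (\<integral>x. \<bar>?E n f x - f x\<bar> \<partial>M) + \<bar>b\<bar> * (\<integral>x. \<bar>?E n g x - g x\<bar> \<partial>M))
      \<longlonglongrightarrow> \<bar>a\<bar> * 0 + \<bar>b\<bar> * 0"
    using f(2) g(2) unfolding L1_approximable_def by (intro tendsto_intros)
  then have lim: "(\<lambda>n. \<bar>a\<bar> * (\<integral>x. \<bar>?E n f x - f x\<bar> \<partial>M) + \<bar>b\<bar> * (\<integral>x. \<bar>?E n g x - g x\<bar> \<partial>M)) \<longlonglongrightarrow> 0"
    by simp
  show ?thesis
    unfolding L1_approximable_def
    by (rule Lim_null_comparison[OF _ lim], rule always_eventually) (use bound in simp)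
qed

lemma L1_approximable_limit:
  assumes s: "\<And>i. integrable M (s i)" "\<And>i. L1_approximable F (s i)" and f: "integrable M f"
    and lim: "(\<lambda>i::nat. \<integral>x. \<bar>s i x - f x\<bar> \<partial>M) \<longlonglongrightarrow> 0"
  shows "L1_approximable F f"
  unfolding L1_approximable_def
proof (rule LIMSEQ_I)
  let ?E = "\<lambda>n. real_cond_exp M (F n)"
  fix e :: real assume e: "0 < e"
  obtain i where "norm ((\<integral>x. \<bar>s i x - f x\<bar> \<partial>M) - 0) < e / 3"
    using LIMSEQ_D[OF lim, of "e / 3"] e by auto
  then have i: "(\<integral>x. \<bar>s i x - f x\<bar> \<partial>M) < e / 3" by simp
  then have i': "(\<integral>x. \<bar>f x - s i x\<bar> \<partial>M) < e / 3" by (simp add: abs_minus_commute)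
  obtain N where N: "\<And>n. n \<ge> N \<Longrightarrow> norm ((\<integral>x. \<bar>?E n (s i) x - s i x\<bar> \<partial>M) - 0) < e / 3"
    using LIMSEQ_D[OF s(2)[of i, unfolded L1_approximable_def], of "e / 3"] e by auto
  have "norm ((\<integral>x. \<bar>?E n f x - f x\<bar> \<partial>M) - 0) < e" if "n \<ge> N" for n
  proof -
    interpret sigma_finite_subalgebra M "F n"
      by (rule sigma_finite_subalgebra_of_subalgebra[OF F])
    note I = real_cond_exp_int(1)[OF f] real_cond_exp_int(1)[OF s(1)]
    have "(\<integral>x. \<bar>?E n f x - f x\<bar> \<partial>M)
        \<le> (\<integral>x. \<bar>?E n f x - ?E n (s i) x\<bar> \<partial>M) + (\<integral>x. \<bar>?E n (s i) x - f x\<bar> \<partial>M)"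
      using I f by (intro L1_dist_triangle)
    moreover have "(\<integral>x. \<bar>?E n f x - ?E n (s i) x\<bar> \<partial>M) \<le> (\<integral>x. \<bar>f x - s i x\<bar> \<partial>M)"
      by (rule real_cond_exp_L1_contraction[OF F f s(1)])
    moreover have "(\<integral>x. \<bar>?E n (s i) x - f x\<bar> \<partial>M)
        \<le> (\<integral>x. \<bar>?E n (s i) x - s i x\<bar> \<partial>M) + (\<integral>x. \<bar>s i x - f x\<bar> \<partial>M)"
      using I f s(1) by (intro L1_dist_triangle)
    moreover have "(\<integral>x. \<bar>?E n (s i) x - s i x\<bar> \<partial>M) < e / 3" using N[OF that] by simp
    moreover have "0 \<le> (\<integral>x. \<bar>?E n f x - f x\<bar> \<partial>M)" by simp
    ultimately show ?thesis using i i' by simp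
  qed
  then show "\<exists>N. \<forall>n\<ge>N. norm ((\<integral>x. \<bar>?E n f x - f x\<bar> \<partial>M) - 0) < e" by blast
qed

lemma L1_approximable_dominated_limit:
  assumes s: "\<And>i::nat. integrable M (s i)" "\<And>i. L1_approximable F (s i)" and f: "integrable M f"
    and w: "integrable M w" "\<And>i x. x \<in> space M \<Longrightarrow> \<bar>s i x\<bar> \<le> w x"
    and lim: "\<And>x. x \<in> space M \<Longrightarrow> (\<lambda>i. s i x) \<longlonglongrightarrow> f x"
  shows "L1_approximable F f"
proof (rule L1_approximable_limit[OF s f])
  have "(\<lambda>i. \<integral>x. \<bar>s i x - f x\<bar> \<partial>M) \<longlonglongrightarrow> (\<integral>x. 0 \<partial>M)"
  proof (rule integral_dominated_convergence[where w="\<lambda>x. w x + \<bar>f x\<bar>"])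
    show "AE x in M. (\<lambda>i. \<bar>s i x - f x\<bar>) \<longlonglongrightarrow> 0"
    proof (rule AE_I2)
      fix x assume "x \<in> space M"
      from tendsto_rabs[OF tendsto_diff[OF lim[OF this] tendsto_const[of "f x"]]]
      show "(\<lambda>i. \<bar>s i x - f x\<bar>) \<longlonglongrightarrow> 0" by simp
    qed
    show "AE x in M. norm \<bar>s i x - f x\<bar> \<le> w x + \<bar>f x\<bar>" for i
      using w(2) by (intro AE_I2) (simp add: abs_triangle_ineq4[THEN order_trans])
  qed (use s f w in auto)
  then show "(\<lambda>i. \<integral>x. \<bar>s i x - f x\<bar> \<partial>M) \<longlonglongrightarrow> 0" by simp
qed

lemma L1_approximable_indicator:
  assumes "A \<in> sigma_sets (space M) (\<Union>n. sets (F n))"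
  shows "L1_approximable F (indicator A)"
proof -
  let ?G = "\<Union>n. sets (F n)"
  have GM: "?G \<subseteq> events" using F by (auto simp: subalgebra_def)
  have int: "integrable M (indicator A :: 'a \<Rightarrow> real)" if "A \<in> sigma_sets (space M) ?G" for A
    using sets.sigma_sets_subset[OF GM] that by (intro integrable_indicator_event) auto
  have stable: "Int_stable ?G"
  proof (rule Int_stableI)
    fix a b assume "a \<in> ?G" "b \<in> ?G"
    then obtain m n where "a \<in> sets (F m)" "b \<in> sets (F n)" by auto
    then have "a \<in> sets (F (max m n))" "b \<in> sets (F (max m n))"
      using filtration_mono[of m "max m n"] filtration_mono[of n "max m n"] by auto
    then show "a \<inter> b \<in> ?G" by blast
  qed
  have gen: "L1_approximable F (indicator A)" if A: "A \<in> ?G" for A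
  proof -
    obtain m where m: "A \<in> sets (F m)" using A by auto
    have "(\<integral>x. \<bar>real_cond_exp M (F n) (indicator A) x - indicator A x\<bar> \<partial>M) = 0" if "m \<le> n" for n
    proof -
      interpret sigma_finite_subalgebra M "F n"
        by (rule sigma_finite_subalgebra_of_subalgebra[OF F])
      have "A \<in> sets (F n)" using m filtration_mono[OF that] by auto
      then have "AE x in M. real_cond_exp M (F n) (indicator A) x = indicator A x"
        using int A by (intro real_cond_exp_F_meas) auto
      then have "AE x in M. \<bar>real_cond_exp M (F n) (indicator A) x - indicator A x\<bar> = 0"
        by eventually_elim simp
      then show ?thesis by (rule integral_eq_zero_AE)
    qed
    then show ?thesis
      unfolding L1_approximable_def by (intro tendsto_eventually) (auto simp: eventually_sequentially)
  qed
  have closed: "?G \<subseteq> Pow (space M)" using GM sets.space_closed by blast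
  from stable closed assms show ?thesis
  proof (induct rule: sigma_sets_induct_disjoint)
    case (basic A)
    then show ?case by (rule gen)
  next
    case empty
    show ?case using F by (intro gen) auto
  next
    case (compl A)
    have "space M \<in> sets (F 0)" using F[of 0] by (metis sets.top subalgebra_def)
    then have sp: "space M \<in> ?G" by blast
    have "L1_approximable F (\<lambda>x. 1 * indicator (space M) x + (-1) * indicator A x)"
      using compl int[of A] int[of "space M"] gen[OF sp] sp by (intro L1_approximable_lincomb) auto
    moreover have "A \<subseteq> space M"
      using sigma_sets_into_sp[OF _ compl(1)] GM sets.space_closed by blast
    then have "(\<lambda>x. 1 * indicator (space M) x + (-1) * indicator A x) = (indicator (space M - A) :: 'a \<Rightarrow> real)"
      by (auto simp: indicator_def fun_eq_iff)
    ultimately show ?case by simp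
  next
    case (union A)
    have partial: "L1_approximable F (indicator (\<Union>j<i. A j))" for i
    proof (induction i)
      case 0
      show ?case using F by (intro gen) auto
    next
      case (Suc i)
      have "L1_approximable F (\<lambda>x. 1 * indicator (\<Union>j<i. A j) x + 1 * indicator (A i) x)"
        by (intro L1_approximable_lincomb int Suc union) (use union in \<open>auto intro!: sigma_sets_UNION\<close>)
      moreover have "A i \<inter> (\<Union>j<i. A j) = {}"
        using union(1) by (auto simp: disjoint_family_on_def) (metis UNIV_I disjoint_iff less_irrefl)
      then have "(\<lambda>x. 1 * indicator (\<Union>j<i. A j) x + 1 * indicator (A i) x) = (indicator (\<Union>j<Suc i. A j) :: 'a \<Rightarrow> real)"
        by (auto simp: indicator_def fun_eq_iff lessThan_Suc)
      ultimately show ?case by simp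
    qed
    show ?case
    proof (rule L1_approximable_dominated_limit[where s="\<lambda>i. indicator (\<Union>j<i. A j)" and w="\<lambda>_. 1"])
      show "integrable M (indicator (\<Union>j<i. A j) :: 'a \<Rightarrow> real)" for i
        using union by (intro int) (auto intro!: sigma_sets_UNION)
      show "integrable M (indicator (\<Union>i. A i) :: 'a \<Rightarrow> real)"
        using union by (intro int sigma_sets.Union) auto
      show "(\<lambda>i. indicator (\<Union>j<i. A j) x) \<longlonglongrightarrow> (indicator (\<Union>i. A i) x :: real)" for x
        by (rule LIMSEQ_indicator_UN)
    qed (use partial in \<open>auto simp: indicator_def\<close>)
  qed
qed

text \<open>Levy's upward theorem in \<open>L\<^sup>1\<close>. Since conditional expectations can be nested, only the
  \<open>K\<close>-measurable function \<open>real_cond_exp M K f\<close> has to be approximated.\<close>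

lemma real_cond_exp_L1_convergence:
  assumes K: "subalgebra M K" and gen: "sets K = sigma_sets (space M) (\<Union>n. sets (F n))" and f: "integrable M f"
  shows "(\<lambda>n. \<integral>x. \<bar>real_cond_exp M (F n) f x - real_cond_exp M K f x\<bar> \<partial>M) \<longlonglongrightarrow> 0"
proof -
  interpret K: sigma_finite_subalgebra M K
    by (rule sigma_finite_subalgebra_of_subalgebra[OF K])
  let ?g = "real_cond_exp M K f"
  have appr: "L1_approximable F g" if g: "integrable (restr_to_subalg M K) g" for g
    using g
  proof (induct rule: integrable_induct)
    case (base A c)
    then have A: "A \<in> sets K" by (simp add: sets_restr_to_subalg[OF K])
    then have "integrable M (indicator A :: 'a \<Rightarrow> real)"
      using K by (intro integrable_indicator_event) (auto simp: subalgebra_def)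
    from L1_approximable_lincomb[OF this _ this, of c 0] L1_approximable_indicator[of A] A gen
    show ?case by (simp add: mult.commute)
  next
    case (add g h)
    then show ?case
      using L1_approximable_lincomb[OF integrable_from_subalg[OF K add(1)] _ integrable_from_subalg[OF K add(3)], of 1 1] add(2,4)
      by simp
  next
    case (lim g s)
    show ?case
    proof (rule L1_approximable_dominated_limit[where s=s and w="\<lambda>x. 2 * \<bar>g x\<bar>"])
      show "integrable M (s i)" for i by (rule integrable_from_subalg[OF K lim(1)])
      show "integrable M g" by (rule integrable_from_subalg[OF K lim(5)])
      then show "integrable M (\<lambda>x. 2 * \<bar>g x\<bar>)" by auto
    qed (use lim in \<open>auto simp: space_restr_to_subalg\<close>)
  qed
  have "integrable (restr_to_subalg M K) ?g"
    by (rule integrable_in_subalg[OF K borel_measurable_cond_exp K.real_cond_exp_int(1)[OF f]])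
  from appr[OF this] have "(\<lambda>n. \<integral>x. \<bar>real_cond_exp M (F n) ?g x - ?g x\<bar> \<partial>M) \<longlonglongrightarrow> 0"
    by (simp add: L1_approximable_def)
  moreover have "(\<integral>x. \<bar>real_cond_exp M (F n) ?g x - ?g x\<bar> \<partial>M) = (\<integral>x. \<bar>real_cond_exp M (F n) f x - ?g x\<bar> \<partial>M)" for n
  proof -
    interpret sigma_finite_subalgebra M "F n"
      by (rule sigma_finite_subalgebra_of_subalgebra[OF F])
    have "subalgebra K (F n)"
      using F[of n] K gen by (auto simp: subalgebra_def)
    then have "AE x in M. real_cond_exp M (F n) ?g x = real_cond_exp M (F n) f x"
      using f K by (intro real_cond_exp_nested_subalg)
    then show ?thesis
      by (intro integral_cong_AE) auto
  qed
  ultimately show ?thesis by simp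
qed

end

section \<open>Continuity of conditional entropy along a filtration\<close>

text \<open>Uniform continuity of \<open>x \<mapsto> x * ln x\<close> on the unit interval in a form that can be integrated directly, so
  that \<open>L\<^sup>1\<close>-convergence of the arguments carries over to the integrals. With \<open>d\<close> a
  modulus of continuity for \<open>e\<close>, distances at least \<open>d\<close> are paid for by the Lipschitz term.\<close>

lemma uniform_bound_xlnx:
  fixes e :: real
  assumes e: "0 < e"
  obtains C where "0 \<le> C"
    "\<And>a b. 0 \<le> a \<Longrightarrow> a \<le> 1 \<Longrightarrow> 0 \<le> b \<Longrightarrow> b \<le> 1 \<Longrightarrow> \<bar>a * ln a - b * ln b\<bar> \<le> e + C * \<bar>a - b\<bar>"
proof -
  let ?p = "\<lambda>x::real. x * ln x"
  have "continuous (at x within {0..1}) ?p" if "x \<in> {0..1}" for x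
  proof (cases "x = 0")
    case True
    have "(?p \<longlongrightarrow> 0) (at_right 0)" by real_asymp
    then have "(?p \<longlongrightarrow> 0) (at 0 within {0..1})"
      using at_within_Icc_at_right[of 0 "1::real"] by simp
    then show ?thesis using True by (simp add: continuous_within)
  next
    case False
    with that have "isCont ?p x" by (intro continuous_intros) auto
    then show ?thesis by (rule continuous_at_imp_continuous_within)
  qed
  then have cont: "continuous_on {0..1} ?p"
    by (simp add: continuous_on_eq_continuous_within)
  then have "uniformly_continuous_on {0..1} ?p"
    by (intro compact_uniformly_continuous) auto
  then obtain d where d: "d > 0"
    "\<And>a b. a \<in> {0..1} \<Longrightarrow> b \<in> {0..1} \<Longrightarrow> dist a b < d \<Longrightarrow> dist (?p a) (?p b) < e"
    using e unfolding uniformly_continuous_on_def by metis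
  have "bounded (?p ` {0..1})"
    by (intro compact_imp_bounded compact_continuous_image cont) auto
  then obtain B where "\<forall>y\<in>?p ` {0..1}. norm y \<le> B"
    unfolding bounded_iff by blast
  then have B: "\<bar>?p a\<bar> \<le> B" if "a \<in> {0..1}" for a
    using that by auto
  have B0: "0 \<le> B" using B[of 0] by simp
  show ?thesis
  proof (rule that[of "2 * B / d"])
    show "0 \<le> 2 * B / d" using B0 d by simp
    fix a b :: real assume ab: "0 \<le> a" "a \<le> 1" "0 \<le> b" "b \<le> 1"
    show "\<bar>a * ln a - b * ln b\<bar> \<le> e + 2 * B / d * \<bar>a - b\<bar>"
    proof (cases "\<bar>a - b\<bar> < d")
      case True
      then have "\<bar>a * ln a - b * ln b\<bar> < e"
        using d(2)[of a b] ab by (simp add: dist_real_def)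
      moreover have "0 \<le> 2 * B / d * \<bar>a - b\<bar>" using B0 d by simp
      ultimately show ?thesis by simp
    next
      case False
      have "\<bar>a * ln a - b * ln b\<bar> \<le> \<bar>a * ln a\<bar> + \<bar>b * ln b\<bar>" by (rule abs_triangle_ineq4)
      also have "\<dots> \<le> 2 * B" using B[of a] B[of b] ab by simp
      also have "\<dots> = 2 * B / d * d" using d by simp
      also have "\<dots> \<le> 2 * B / d * \<bar>a - b\<bar>"
        using False B0 d by (intro mult_left_mono) auto
      finally show ?thesis using e by simp
    qed
  qed
qed

lemma integral_xlnx_convergence:
  fixes f :: "nat \<Rightarrow> 'a \<Rightarrow> real" and g :: "'a \<Rightarrow> real"
  assumes f: "\<And>n. f n \<in> borel_measurable M" "\<And>n. AE x in M. 0 \<le> f n x \<and> f n x \<le> 1"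
    and g: "g \<in> borel_measurable M" "AE x in M. 0 \<le> g x \<and> g x \<le> 1"
    and lim: "(\<lambda>n. \<integral>x. \<bar>f n x - g x\<bar> \<partial>M) \<longlonglongrightarrow> 0"
  shows "(\<lambda>n. \<integral>x. - f n x * ln (f n x) \<partial>M) \<longlonglongrightarrow> (\<integral>x. - g x * ln (g x) \<partial>M)"
    and "integrable M (\<lambda>x. - g x * ln (g x))"
proof -
  obtain B where B: "\<And>a b. 0 \<le> a \<Longrightarrow> a \<le> 1 \<Longrightarrow> 0 \<le> b \<Longrightarrow> b \<le> 1 \<Longrightarrow> \<bar>a * ln a - b * ln b\<bar> \<le> (1::real) + B * \<bar>a - b\<bar>"
    by (rule uniform_bound_xlnx[of 1]) auto
  have int: "integrable M (\<lambda>x. - h x * ln (h x))" "integrable M h"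
    if h [measurable]: "h \<in> borel_measurable M" and b: "AE x in M. 0 \<le> h x \<and> h x \<le> 1" for h :: "'a \<Rightarrow> real"
  proof -
    have "AE x in M. norm (- h x * ln (h x)) \<le> 1 + \<bar>B\<bar>"
      using b
    proof eventually_elim
      case (elim x)
      have "\<bar>h x * ln (h x)\<bar> \<le> 1 + B * \<bar>h x\<bar>" using B[of "h x" 0] elim by simp
      also have "\<dots> \<le> 1 + \<bar>B\<bar> * 1" using elim by (intro add_left_mono mult_mono) auto
      finally show ?case by simp
    qed
    then show "integrable M (\<lambda>x. - h x * ln (h x))" by (rule integrable_const_bound) measurable
    show "integrable M h" by (rule integrable_const_bound[of _ 1]) (use b in auto)
  qed
  show "integrable M (\<lambda>x. - g x * ln (g x))" by (rule int[OF g])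
  show "(\<lambda>n. \<integral>x. - f n x * ln (f n x) \<partial>M) \<longlonglongrightarrow> (\<integral>x. - g x * ln (g x) \<partial>M)"
  proof (rule LIMSEQ_I)
    fix e :: real assume e: "0 < e"
    obtain C where C: "0 \<le> C" "\<And>a b. 0 \<le> a \<Longrightarrow> a \<le> 1 \<Longrightarrow> 0 \<le> b \<Longrightarrow> b \<le> 1 \<Longrightarrow> \<bar>a * ln a - b * ln b\<bar> \<le> e / 2 + C * \<bar>a - b\<bar>"
      by (rule uniform_bound_xlnx[of "e / 2"]) (use e in auto)
    obtain N where N: "\<And>n. n \<ge> N \<Longrightarrow> norm ((\<integral>x. \<bar>f n x - g x\<bar> \<partial>M) - 0) < e / (2 * (C + 1))"
      using LIMSEQ_D[OF lim, of "e / (2 * (C + 1))"] e C by auto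
    have "norm ((\<integral>x. - f n x * ln (f n x) \<partial>M) - (\<integral>x. - g x * ln (g x) \<partial>M)) < e" if n: "n \<ge> N" for n
    proof -
      have "norm ((\<integral>x. - f n x * ln (f n x) \<partial>M) - (\<integral>x. - g x * ln (g x) \<partial>M))
          = \<bar>\<integral>x. - f n x * ln (f n x) - - g x * ln (g x) \<partial>M\<bar>"
        using int[OF f] int[OF g] by (subst Bochner_Integration.integral_diff) auto
      also have "\<dots> \<le> (\<integral>x. \<bar>- f n x * ln (f n x) - - g x * ln (g x)\<bar> \<partial>M)"
        by (rule integral_abs_bound)
      also have "\<dots> \<le> (\<integral>x. e / 2 + C * \<bar>f n x - g x\<bar> \<partial>M)"
      proof (rule integral_mono_AE)
        show "integrable M (\<lambda>x. \<bar>- f n x * ln (f n x) - - g x * ln (g x)\<bar>)"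
          by (intro Bochner_Integration.integrable_abs Bochner_Integration.integrable_diff int f g)
        show "integrable M (\<lambda>x. e / 2 + C * \<bar>f n x - g x\<bar>)"
          using int(2)[OF f] int(2)[OF g] by auto
        show "AE x in M. \<bar>- f n x * ln (f n x) - - g x * ln (g x)\<bar> \<le> e / 2 + C * \<bar>f n x - g x\<bar>"
          using f(2)[of n] g(2)
        proof eventually_elim
          case (elim x)
          then show ?case using C(2)[of "f n x" "g x"] by (simp add: abs_minus_commute)
        qed
      qed
      also have "\<dots> = e / 2 + C * (\<integral>x. \<bar>f n x - g x\<bar> \<partial>M)"
        using int(2)[OF f] int(2)[OF g] by (subst Bochner_Integration.integral_add) (auto simp: prob_space)
      also have "\<dots> \<le> e / 2 + C * (e / (2 * (C + 1)))"
        using N[OF n] C by (intro add_left_mono mult_left_mono) auto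
      also have "\<dots> < e"
        using C e by (simp add: field_simps)
      finally show ?thesis .
    qed
    then show "\<exists>N. \<forall>n\<ge>N. norm ((\<integral>x. - f n x * ln (f n x) \<partial>M) - (\<integral>x. - g x * ln (g x) \<partial>M)) < e" by blast
  qed
qed

lemma cell_entropy_convergence:
  assumes F: "\<And>n. subalgebra M (F n)" "\<And>n. subalgebra (F (Suc n)) (F n)"
    and K: "subalgebra M K" "sets K = sigma_sets (space M) (\<Union>n. sets (F n))" and A: "A \<in> events"
  shows "(\<lambda>n. cell_entropy (F n) A) \<longlonglongrightarrow> cell_entropy K A"
proof -
  have eq: "cell_entropy H A = ennreal (\<integral>x. - real_cond_exp M H (indicator A) x * ln (real_cond_exp M H (indicator A) x) \<partial>M)"
    if H: "subalgebra M H" for H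
    unfolding cell_entropy_eq[OF H A]
  proof (rule nn_integral_eq_integral)
    note b = real_cond_exp_indicator_bounds[OF H A]
    show "integrable M (\<lambda>x. - real_cond_exp M H (indicator A) x * ln (real_cond_exp M H (indicator A) x))"
      by (rule integral_xlnx_convergence(2)[of "\<lambda>_. real_cond_exp M H (indicator A)"]) (use b in auto)
    show "AE x in M. 0 \<le> - real_cond_exp M H (indicator A) x * ln (real_cond_exp M H (indicator A) x)"
      using b
    proof eventually_elim
      case (elim x)
      then show ?case by (cases "real_cond_exp M H (indicator A) x = 0") (auto simp: mult_nonneg_nonpos)
    qed
  qed
  show ?thesis
    unfolding eq[OF F(1)] eq[OF K(1)]
    by (intro tendsto_ennrealI integral_xlnx_convergence(1) real_cond_exp_indicator_bounds F K A
        real_cond_exp_L1_convergence integrable_indicator_event) auto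
qed

text \<open>Each cell converges, and the sum over the cells is dominated by the finite entropy of \<open>P\<close>.\<close>

lemma cond_entropy_convergence:
  assumes P: "meas_partition M P" "Defs.entropy M P < \<infinity>"
    and F: "\<And>n. subalgebra M (F n)" "\<And>n. subalgebra (F (Suc n)) (F n)"
    and K: "subalgebra M K" "sets K = sigma_sets (space M) (\<Union>n. sets (F n))"
  shows "(\<lambda>n. cond_entropy M P (F n)) \<longlonglongrightarrow> cond_entropy M P K"
  unfolding cond_entropy_eq_cells[OF P(1)]
proof (rule nn_integral_dominated_convergence[where w="\<lambda>A. ennreal (- prob A * ln (prob A))"])
  show "(\<integral>\<^sup>+A. ennreal (- prob A * ln (prob A)) \<partial>count_space P) < \<infinity>"
    using P by (simp add: entropy_eq_nn_integral_cells)
  show "AE A in count_space P. cell_entropy (F n) A \<le> ennreal (- prob A * ln (prob A))" for n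
    using meas_partition_cell(1)[OF P(1)] cell_entropy_le[OF F(1)] by (simp add: AE_count_space)
  show "AE A in count_space P. (\<lambda>n. cell_entropy (F n) A) \<longlonglongrightarrow> cell_entropy K A"
    using meas_partition_cell(1)[OF P(1)] by (auto simp: AE_count_space intro!: cell_entropy_convergence F K)
qed auto

section \<open>Partitions of finite entropy\<close>

definition finite_entropy :: "'a set set \<Rightarrow> bool" where
  "finite_entropy P \<longleftrightarrow> meas_partition M P \<and> Defs.entropy M P < \<infinity>"

text \<open>All partitions that occur in the addition formula have finite entropy, and their entropies are added
  and subtracted freely; the type of real numbers is the convenient place for that.\<close>

definition real_entropy :: "'a set set \<Rightarrow> real" where
  "real_entropy P = enn2real (Defs.entropy M P)"

lemma finite_entropy_imp_meas_partition: "finite_entropy P \<Longrightarrow> meas_partition M P"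
  by (simp add: finite_entropy_def)

lemma entropy_eq_real_entropy: "finite_entropy P \<Longrightarrow> Defs.entropy M P = ennreal (real_entropy P)"
  by (simp add: finite_entropy_def real_entropy_def)

lemma real_entropy_nonneg: "0 \<le> real_entropy P"
  by (simp add: real_entropy_def)

lemma finite_entropy_pjoin:
  assumes "finite_entropy P" "finite_entropy Q"
  shows "finite_entropy (pjoin P Q)"
  using assms entropy_pjoin_le[of P Q] meas_partition_pjoin[of M P Q]
  by (auto simp: finite_entropy_def intro: le_less_trans)

lemma finite_entropy_pullback:
  assumes "finite_entropy P" "measure_preserving_map M t"
  shows "finite_entropy (pullback M t P)"
  using assms entropy_pullback[of P t] meas_partition_pullback[of M P t]
  by (simp add: finite_entropy_def measure_preserving_map_def)

lemma real_entropy_pullback: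
  assumes "finite_entropy P" "measure_preserving_map M t"
  shows "real_entropy (pullback M t P) = real_entropy P"
  using assms by (simp add: real_entropy_def finite_entropy_def entropy_pullback)

lemma real_entropy_cong:
  assumes "meas_partition M P" "meas_partition M Q" "\<And>x. x \<in> space M \<Longrightarrow> atom_of P x = atom_of Q x"
  shows "real_entropy P = real_entropy Q"
  using entropy_cong[OF assms] by (simp add: real_entropy_def)

lemma real_entropy_submodular:
  assumes "finite_entropy P" "finite_entropy Q" "finite_entropy R"
  shows "real_entropy (pjoin P (pjoin Q R)) + real_entropy R \<le> real_entropy (pjoin P R) + real_entropy (pjoin Q R)"
proof -
  have "ennreal (real_entropy (pjoin P (pjoin Q R)) + real_entropy R) \<le> ennreal (real_entropy (pjoin P R) + real_entropy (pjoin Q R))"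
    using entropy_submodular[of P Q R] assms
    by (simp add: entropy_eq_real_entropy finite_entropy_pjoin finite_entropy_imp_meas_partition ennreal_plus real_entropy_nonneg)
  then show ?thesis
    by (simp add: real_entropy_nonneg ennreal_le_iff del: ennreal_plus)
qed

lemma real_entropy_chain_rule:
  assumes P: "finite_entropy P" and Q: "finite_entropy Q"
  shows "real_entropy (pjoin P Q) - real_entropy Q = enn2real (cond_entropy M P (sigma (space M) Q))"
proof -
  note PQ = finite_entropy_imp_meas_partition[OF P] finite_entropy_imp_meas_partition[OF Q]
  have "cond_entropy M P (sigma (space M) Q) \<le> Defs.entropy M P"
    by (rule cond_entropy_le_entropy[OF PQ(1) subalgebra_sigma_partition[OF PQ(2)]])
  then have "cond_entropy M P (sigma (space M) Q) < \<infinity>" "Defs.entropy M Q < \<infinity>"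
    using P Q by (auto simp: finite_entropy_def)
  then show ?thesis
    by (simp add: real_entropy_def entropy_chain_rule[OF PQ] enn2real_plus)
qed

lemma real_entropy_conditional_convergence:
  assumes P: "finite_entropy P" and Q: "\<And>n. finite_entropy (Q n)" "\<And>n. refines M (Q (Suc n)) (Q n)"
    and K: "subalgebra M K" "sets K = sigma_sets (space M) (\<Union>n. sigma_sets (space M) (Q n))"
  shows "(\<lambda>n. real_entropy (pjoin P (Q n)) - real_entropy (Q n)) \<longlonglongrightarrow> enn2real (cond_entropy M P K)"
proof -
  note mp = finite_entropy_imp_meas_partition
  have "(\<lambda>n. cond_entropy M P (sigma (space M) (Q n))) \<longlonglongrightarrow> cond_entropy M P K"
    by (rule cond_entropy_convergence)
      (use P Q K in \<open>simp_all add: mp subalgebra_sigma_partition subalgebra_sigma_refines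
        sets_sigma_partition finite_entropy_def\<close>)
  moreover have "cond_entropy M P K < \<infinity>"
    using cond_entropy_le_entropy[OF mp[OF P] K(1)] P by (auto simp: finite_entropy_def)
  ultimately have "(\<lambda>n. enn2real (cond_entropy M P (sigma (space M) (Q n)))) \<longlonglongrightarrow> enn2real (cond_entropy M P K)"
    by (intro tendsto_enn2real) auto
  then show ?thesis by (simp add: real_entropy_chain_rule P Q)
qed

end

section \<open>Actions of finitely generated monoids\<close>

text \<open>The common properties of free groups and free monoids on which the addition formula rests: \<open>S\<close> is a
  finite generating set, and each of its elements is one of the \<open>s i\<close> or a left inverse of one.\<close>

locale generated_action = prob_space M + monoid G
  for M :: "'a measure" and G :: "('g, 'm) monoid_scheme" (structure) +
  fixes r :: nat and s :: "nat \<Rightarrow> 'g" and S :: "'g set" and T :: "'g \<Rightarrow> 'a \<Rightarrow> 'a"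
  assumes finite_S: "finite S" and S_carrier: "S \<subseteq> carrier G"
    and S_generates: "\<And>g. g \<in> carrier G \<Longrightarrow> \<exists>w\<in>lists S. foldr (\<otimes>) w \<one> = g"
    and s_in_S: "\<And>i. i \<in> {1..r} \<Longrightarrow> s i \<in> S"
    and S_letters: "\<And>t. t \<in> S \<Longrightarrow> \<exists>i\<in>{1..r}. t = s i \<or> t \<otimes> s i = \<one>"
    and mp: "mp_action G M T"
begin

lemma T_mp: "g \<in> carrier G \<Longrightarrow> measure_preserving_map M (T g)"
  and T_one: "x \<in> space M \<Longrightarrow> T \<one> x = x"
  and T_mult: "g \<in> carrier G \<Longrightarrow> h \<in> carrier G \<Longrightarrow> x \<in> space M \<Longrightarrow> T (g \<otimes> h) x = T g (T h x)"
  using mp by (auto simp: mp_action_def)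

lemma T_measurable: "g \<in> carrier G \<Longrightarrow> T g \<in> measurable M M"
  using T_mp by (simp add: measure_preserving_map_def)

lemma T_space: "g \<in> carrier G \<Longrightarrow> x \<in> space M \<Longrightarrow> T g x \<in> space M"
  using measurable_space[OF T_measurable] by blast

lemma s_carrier: "i \<in> {1..r} \<Longrightarrow> s i \<in> carrier G"
  using s_in_S S_carrier by blast

abbreviation shift :: "'g \<Rightarrow> 'a set set \<Rightarrow> 'a set set" where
  "shift g P \<equiv> pullback M (T g) P"

lemma meas_partition_shift: "meas_partition M P \<Longrightarrow> g \<in> carrier G \<Longrightarrow> meas_partition M (shift g P)"
  by (rule meas_partition_pullback[OF _ T_measurable])

lemma atom_of_shift:
  "meas_partition M P \<Longrightarrow> g \<in> carrier G \<Longrightarrow> x \<in> space M \<Longrightarrow>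
    atom_of (shift g P) x = T g -` atom_of P (T g x) \<inter> space M"
  by (rule atom_of_pullback[OF _ T_measurable])

lemma finite_entropy_shift: "finite_entropy P \<Longrightarrow> g \<in> carrier G \<Longrightarrow> finite_entropy (shift g P)"
  by (rule finite_entropy_pullback[OF _ T_mp])

lemma real_entropy_shift: "finite_entropy P \<Longrightarrow> g \<in> carrier G \<Longrightarrow> real_entropy (shift g P) = real_entropy P"
  by (rule real_entropy_pullback[OF _ T_mp])

section \<open>Splittings\<close>

definition F_real :: "'a set set \<Rightarrow> real" where
  "F_real P = (1 - 2 * real r) * real_entropy P + (\<Sum>i = 1..r. real_entropy (pjoin P (shift (s i) P)))"

lemma F_fun_eq_F_real:
  assumes P: "finite_entropy P"
  shows "F_fun M r s T P = ereal (F_real P)"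
proof -
  have "enn2ereal (Defs.entropy M (pjoin P (shift (s i) P))) = ereal (real_entropy (pjoin P (shift (s i) P)))"
    if "i \<in> {1..r}" for i
    using P s_carrier[OF that]
    by (simp add: entropy_eq_real_entropy finite_entropy_pjoin finite_entropy_shift real_entropy_nonneg enn2ereal_ennreal)
  then have "(\<Sum>i = 1..r. enn2ereal (Defs.entropy M (pjoin P (shift (s i) P))))
      = (\<Sum>i = 1..r. ereal (real_entropy (pjoin P (shift (s i) P))))"
    by (intro sum.cong) auto
  then show ?thesis
    by (simp add: F_fun_def F_real_def entropy_eq_real_entropy[OF P] real_entropy_nonneg enn2ereal_ennreal)
qed

lemma F_real_cong:
  assumes P: "meas_partition M P" and Q: "meas_partition M Q"
    and eq: "\<And>x. x \<in> space M \<Longrightarrow> atom_of P x = atom_of Q x"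
  shows "F_real P = F_real Q"
proof -
  have "real_entropy (pjoin P (shift (s i) P)) = real_entropy (pjoin Q (shift (s i) Q))" if "i \<in> {1..r}" for i
    using s_carrier[OF that]
    by (intro real_entropy_cong) (simp_all add: P Q eq T_space meas_partition_pjoin meas_partition_shift atom_of_pjoin[where M=M] atom_of_shift)
  then show ?thesis
    using real_entropy_cong[OF assms] by (simp add: F_real_def)
qed

text \<open>Let \<open>E = shift t Y\<close> and let \<open>d\<close> be the conditional entropy of \<open>E\<close> given \<open>X\<close>. Refining \<open>X\<close> to
  \<open>pjoin X E\<close> adds \<open>d\<close> to the entropy of \<open>X\<close>. For each generator \<open>s i\<close> it adds at most \<open>2 * d\<close> to the entropy
  of \<open>pjoin X (shift (s i) X)\<close>: by submodularity \<open>E\<close> costs at most \<open>d\<close> given \<open>X\<close>, and \<open>shift (s i) E\<close> costs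
  at most \<open>d\<close> given \<open>shift (s i) X\<close>. For the generator that belongs to \<open>t\<close> one of the two is free, since then
  \<open>E\<close> is coarser than \<open>shift (s i) X\<close> or \<open>shift (s i) E\<close> has, in effect, the cells of \<open>Y\<close>. So the sum grows by at
  most \<open>(2 * r - 1) * d\<close>, which the coefficient \<open>1 - 2 * r\<close> of the first term of \<open>F_real\<close> exactly
  compensates.\<close>

lemma F_real_splitting_le:
  assumes X: "finite_entropy X" and Y: "finite_entropy Y" and ref: "refines M X Y" and t: "t \<in> S"
  shows "F_real (pjoin X (shift t Y)) \<le> F_real X"
proof -
  note mpart = finite_entropy_imp_meas_partition
  note parts = meas_partition_pjoin meas_partition_shift mpart atom_of_pjoin[where M=M] atom_of_shift T_space
  note fins = finite_entropy_pjoin finite_entropy_shift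
  have tG: "t \<in> carrier G" using t S_carrier by blast
  define E where "E = shift t Y"
  have E: "finite_entropy E" unfolding E_def by (rule finite_entropy_shift[OF Y tG])
  define d where "d = real_entropy (pjoin X E) - real_entropy X"
  obtain i0 where i0: "i0 \<in> {1..r}" "t = s i0 \<or> t \<otimes> s i0 = \<one>"
    using S_letters[OF t] by blast
  have bound: "real_entropy (pjoin (pjoin X E) (shift (s i) (pjoin X E)))
      \<le> real_entropy (pjoin X (shift (s i) X)) + (if i = i0 then d else 2 * d)"
    if i: "i \<in> {1..r}" for i
  proof -
    note si = s_carrier[OF i]
    let ?X' = "shift (s i) X" and ?E' = "shift (s i) E"
    have all: "real_entropy (pjoin (pjoin X E) (shift (s i) (pjoin X E))) = real_entropy (pjoin (pjoin X E) (pjoin ?E' ?X'))"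
      by (rule real_entropy_cong) (auto simp: parts X E si)
    have left: "real_entropy (pjoin (pjoin X E) ?X') \<le> real_entropy (pjoin X ?X') + d"
    proof -
      have "real_entropy (pjoin ?X' (pjoin E X)) + real_entropy X \<le> real_entropy (pjoin ?X' X) + real_entropy (pjoin E X)"
        by (intro real_entropy_submodular fins X E si)
      moreover have "real_entropy (pjoin ?X' (pjoin E X)) = real_entropy (pjoin (pjoin X E) ?X')"
        by (rule real_entropy_cong) (auto simp: parts X E si)
      moreover have "real_entropy (pjoin ?X' X) = real_entropy (pjoin X ?X')"
        by (rule real_entropy_cong) (auto simp: parts X E si)
      moreover have "real_entropy (pjoin E X) = real_entropy (pjoin X E)"
        by (rule real_entropy_cong) (auto simp: parts X E si)
      ultimately show ?thesis by (simp add: d_def)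
    qed
    have right: "real_entropy (pjoin (pjoin X E) (pjoin ?E' ?X')) \<le> real_entropy (pjoin (pjoin X E) ?X') + d"
    proof -
      have "real_entropy (pjoin (pjoin X E) (pjoin ?E' ?X')) + real_entropy ?X'
          \<le> real_entropy (pjoin (pjoin X E) ?X') + real_entropy (pjoin ?E' ?X')"
        by (intro real_entropy_submodular fins X E si)
      moreover have "real_entropy (pjoin ?E' ?X') = real_entropy (shift (s i) (pjoin X E))"
        by (rule real_entropy_cong) (auto simp: parts X E si)
      ultimately show ?thesis
        using real_entropy_shift[OF finite_entropy_pjoin[OF X E] si] real_entropy_shift[OF X si] by (simp add: d_def)
    qed
    show ?thesis
    proof (cases "i = i0")
      case False
      with all left right show ?thesis by simp
    next
      case True
      from i0(2) True consider "t = s i" | "t \<otimes> s i = \<one>" by auto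
      then show ?thesis
      proof cases
        case 1
        \<comment> \<open>\<open>E\<close> is coarser than \<open>?X'\<close>, so the first step is free.\<close>
        have sub: "atom_of X (T (s i) x) \<subseteq> atom_of Y (T (s i) x)" if "x \<in> space M" for x
          using ref T_space[OF si that] by (simp add: refines_def)
        have "real_entropy (pjoin (pjoin X E) ?X') = real_entropy (pjoin X ?X')"
          by (rule real_entropy_cong) (auto simp: parts X Y E_def si tG 1 intro: sub[THEN subsetD])
        with True all right show ?thesis by simp
      next
        case 2
        \<comment> \<open>On the space \<open>T t \<circ> T (s i)\<close> is the identity, so \<open>?E'\<close> has the cells of \<open>Y\<close>, which is coarser than
          \<open>X\<close>: the second step is free.\<close>
        have "atom_of ?E' x = atom_of Y x \<inter> space M" if x: "x \<in> space M" for x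
        proof -
          have undo: "T t (T (s i) y) = y" if "y \<in> space M" for y
            using T_mult[OF tG si that] 2 T_one[OF that] by simp
          show ?thesis
            using x by (auto simp: parts Y E_def si tG undo)
        qed
        note aE = this
        have "real_entropy (pjoin (pjoin X E) (pjoin ?E' ?X')) = real_entropy (pjoin (pjoin X E) ?X')"
        proof (rule real_entropy_cong)
          fix x assume x: "x \<in> space M"
          have "atom_of X x \<subseteq> atom_of Y x" using ref x by (simp add: refines_def)
          moreover have "atom_of X x \<subseteq> space M"
            by (rule atom_of_subset_space[OF mpart[OF X] x])
          moreover have "atom_of (pjoin (pjoin X E) (pjoin ?E' ?X')) x
              = atom_of X x \<inter> atom_of E x \<inter> (atom_of ?E' x \<inter> atom_of ?X' x)"
            "atom_of (pjoin (pjoin X E) ?X') x = atom_of X x \<inter> atom_of E x \<inter> atom_of ?X' x"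
            by (simp_all add: atom_of_pjoin[where M=M] meas_partition_pjoin meas_partition_shift mpart X E si x)
          ultimately show "atom_of (pjoin (pjoin X E) (pjoin ?E' ?X')) x = atom_of (pjoin (pjoin X E) ?X') x"
            using aE[OF x] by auto
        qed (simp_all add: meas_partition_pjoin meas_partition_shift mpart X E si)
        with True all left show ?thesis by simp
      qed
    qed
  qed
  have "(\<Sum>i = 1..r. real_entropy (pjoin (pjoin X E) (shift (s i) (pjoin X E))))
      \<le> (\<Sum>i = 1..r. real_entropy (pjoin X (shift (s i) X)) + (if i = i0 then d else 2 * d))"
    by (intro sum_mono bound)
  also have "\<dots> = (\<Sum>i = 1..r. real_entropy (pjoin X (shift (s i) X))) + (\<Sum>i = 1..r. 2 * d - (if i = i0 then d else 0))"
    unfolding sum.distrib[symmetric] by (intro sum.cong) auto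
  also have "(\<Sum>i = 1..r. 2 * d - (if i = i0 then d else 0)) = 2 * real r * d - d"
    using i0(1) by (simp add: sum_subtractf)
  finally show ?thesis
    unfolding F_real_def E_def[symmetric] by (simp add: d_def algebra_simps)
qed

section \<open>Joins over finite sets and balls\<close>

lemma join_over_empty: "join_over M T {} P = {space M}"
  by (auto simp: join_over_def)

text \<open>The premise lets the cell chosen for \<open>g\<close> be independent of the choices made for \<open>K\<close>; with \<open>g\<close> in \<open>K\<close>
  the right-hand side may contain additional empty cells.\<close>

lemma join_over_insert:
  assumes "g \<notin> K"
  shows "join_over M T (insert g K) P = pjoin (shift g P) (join_over M T K P)"
proof
  show "join_over M T (insert g K) P \<subseteq> pjoin (shift g P) (join_over M T K P)"
  proof
    fix D assume "D \<in> join_over M T (insert g K) P"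
    then obtain C where C: "\<forall>q\<in>insert g K. C q \<in> shift q P" "D = space M \<inter> (\<Inter>q\<in>insert g K. C q)"
      by (auto simp: join_over_def)
    then have "D = C g \<inter> (space M \<inter> (\<Inter>q\<in>K. C q))" by auto
    moreover have "space M \<inter> (\<Inter>q\<in>K. C q) \<in> join_over M T K P" using C by (auto simp: join_over_def)
    ultimately show "D \<in> pjoin (shift g P) (join_over M T K P)" using C by (auto simp: pjoin_def)
  qed
  show "pjoin (shift g P) (join_over M T K P) \<subseteq> join_over M T (insert g K) P"
  proof
    fix D assume "D \<in> pjoin (shift g P) (join_over M T K P)"
    then obtain A C where D: "D = A \<inter> (space M \<inter> (\<Inter>q\<in>K. C q))" and A: "A \<in> shift g P" and C: "\<forall>q\<in>K. C q \<in> shift q P"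
      by (auto simp: pjoin_def join_over_def)
    have "D = space M \<inter> (\<Inter>q\<in>insert g K. (C(g := A)) q)"
      using D assms by auto
    moreover have "\<forall>q\<in>insert g K. (C(g := A)) q \<in> shift q P" using A C by auto
    ultimately show "D \<in> join_over M T (insert g K) P" unfolding join_over_def by blast
  qed
qed

lemma
  assumes P: "meas_partition M P" and K: "finite K" "K \<subseteq> carrier G"
  shows meas_partition_join_over: "meas_partition M (join_over M T K P)"
    and atom_of_join_over: "x \<in> space M \<Longrightarrow>
      atom_of (join_over M T K P) x = {y \<in> space M. \<forall>q\<in>K. T q y \<in> atom_of P (T q x)}"
proof -
  have "meas_partition M (join_over M T K P) \<and> (\<forall>x\<in>space M.
      atom_of (join_over M T K P) x = {y \<in> space M. \<forall>q\<in>K. T q y \<in> atom_of P (T q x)})"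
    using K
  proof (induction K)
    case empty
    have "atom_of {space M} x = space M" if "x \<in> space M" for x
      by (rule atom_of_eq[OF meas_partition_trivial]) (use that in auto)
    then show ?case by (simp add: join_over_empty meas_partition_trivial)
  next
    case (insert g K)
    then show ?case
      using P by (auto simp: join_over_insert meas_partition_pjoin meas_partition_shift atom_of_pjoin[where M=M] atom_of_shift)
  qed
  then show "meas_partition M (join_over M T K P)"
    "x \<in> space M \<Longrightarrow> atom_of (join_over M T K P) x = {y \<in> space M. \<forall>q\<in>K. T q y \<in> atom_of P (T q x)}"
    by auto
qed

lemma finite_entropy_join_over:
  assumes P: "finite_entropy P" and K: "finite K" "K \<subseteq> carrier G"
  shows "finite_entropy (join_over M T K P)"
  using K
proof (induction K)
  case empty
  have "Defs.entropy M {space M} = 0" by (simp add: Defs.entropy_def prob_space)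
  then show ?case by (simp add: join_over_empty meas_partition_trivial finite_entropy_def)
next
  case (insert g K)
  then show ?case by (simp add: join_over_insert finite_entropy_pjoin finite_entropy_shift P)
qed

lemma F_real_multiple_splitting_le:
  assumes X: "finite_entropy X" and Y: "finite_entropy Y" and ref: "refines M X Y"
    and K: "finite K" "K \<subseteq> S"
  shows "F_real (pjoin X (join_over M T K Y)) \<le> F_real X"
  using K
proof (induction K)
  case empty
  have "F_real (pjoin X (join_over M T {} Y)) = F_real X"
    using X meas_partition_join_over[of Y "{}"] atom_of_join_over[of Y "{}"] Y
      atom_of_subset_space[of M X]
    by (intro F_real_cong) (auto simp: Int_absorb2 meas_partition_pjoin atom_of_pjoin[where M=M] finite_entropy_imp_meas_partition)
  then show ?case by simp
next
  case (insert t K)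
  have KG: "K \<subseteq> carrier G" and tG: "t \<in> carrier G" using insert S_carrier by auto
  note m = finite_entropy_imp_meas_partition
  have J: "finite_entropy (join_over M T K Y)" by (rule finite_entropy_join_over[OF Y insert(1) KG])
  have "F_real (pjoin X (join_over M T (insert t K) Y)) = F_real (pjoin (pjoin X (join_over M T K Y)) (shift t Y))"
    using insert(2)
    by (intro F_real_cong) (auto simp: join_over_insert meas_partition_pjoin meas_partition_shift atom_of_pjoin[where M=M] m X Y J tG)
  also have "\<dots> \<le> F_real (pjoin X (join_over M T K Y))"
  proof (rule F_real_splitting_le)
    show "refines M (pjoin X (join_over M T K Y)) Y"
      using ref by (auto simp: refines_def atom_of_pjoin[where M=M] m X J)
  qed (use insert X Y J in \<open>auto intro: finite_entropy_pjoin\<close>)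
  also have "\<dots> \<le> F_real X" using insert by simp
  finally show ?case .
qed

abbreviation B :: "nat \<Rightarrow> 'g set" where "B \<equiv> word_ball G S"

lemma foldr_closed: "w \<in> lists S \<Longrightarrow> foldr (\<otimes>) w \<one> \<in> carrier G"
  using S_carrier by (induction w) auto

lemma foldr_snoc:
  "w \<in> lists S \<Longrightarrow> t \<in> S \<Longrightarrow> foldr (\<otimes>) (w @ [t]) \<one> = foldr (\<otimes>) w \<one> \<otimes> t"
proof (induction w)
  case (Cons a w)
  then have "a \<in> carrier G" "t \<in> carrier G" "foldr (\<otimes>) w \<one> \<in> carrier G"
    using S_carrier foldr_closed by auto
  with Cons show ?case by (simp add: m_assoc)
qed (use S_carrier in auto)

lemma word_ball_eq: "B n = (\<lambda>w. foldr (\<otimes>) w \<one>) ` {w \<in> lists S. length w \<le> n}"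
proof -
  have "g \<in> B n \<longleftrightarrow> g \<in> (\<lambda>w. foldr (\<otimes>) w \<one>) ` {w \<in> lists S. length w \<le> n}" if g: "g \<in> carrier G" for g
  proof -
    let ?Q = "\<lambda>n. \<exists>w\<in>lists S. length w = n \<and> foldr (\<otimes>) w \<one> = g"
    have "\<exists>n. ?Q n" using S_generates[OF g] by auto
    then have "?Q (word_length G S g)"
      unfolding word_length_def by (rule LeastI_ex)
    moreover have "word_length G S g \<le> k" if "?Q k" for k
      unfolding word_length_def using that by (rule Least_le)
    ultimately have "word_length G S g \<le> n \<longleftrightarrow> (\<exists>k\<le>n. ?Q k)"
      using order_trans by blast
    then show ?thesis using g unfolding word_ball_def by blast
  qed
  then show ?thesis using foldr_closed by (auto simp: word_ball_def)
qed

lemma word_ball_carrier: "B n \<subseteq> carrier G"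
  by (auto simp: word_ball_def)

lemma finite_word_ball: "finite (B n)"
proof -
  have "{w \<in> lists S. length w \<le> n} = {w. set w \<subseteq> S \<and> length w \<le> n}" by auto
  then show ?thesis
    using finite_lists_length_le[OF finite_S] by (simp add: word_ball_eq)
qed

text \<open>The letter is split off on the right because \<open>T (g \<otimes> t) = T g \<circ> T t\<close> makes the pullback along
  \<open>g \<otimes> t\<close> the shift by \<open>t\<close> of the pullback along \<open>g\<close>.\<close>

lemma word_ball_Suc: "B (Suc n) = B n \<union> {g \<otimes> t | g t. g \<in> B n \<and> t \<in> S}"
proof (intro equalityI subsetI)
  fix h assume "h \<in> B (Suc n)"
  then obtain w where w: "w \<in> lists S" "length w \<le> Suc n" "h = foldr (\<otimes>) w \<one>"
    by (auto simp: word_ball_eq)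
  show "h \<in> B n \<union> {g \<otimes> t | g t. g \<in> B n \<and> t \<in> S}"
  proof (cases "length w \<le> n")
    case True
    with w show ?thesis by (auto simp: word_ball_eq)
  next
    case False
    then obtain u t where ut: "w = u @ [t]" by (cases w rule: rev_cases) auto
    with w have u: "u \<in> lists S" "t \<in> S" "length u \<le> n" by auto
    then have "h = foldr (\<otimes>) u \<one> \<otimes> t" using w ut foldr_snoc by simp
    moreover have "foldr (\<otimes>) u \<one> \<in> B n" using u by (auto simp: word_ball_eq)
    ultimately show ?thesis using u by blast
  qed
next
  fix h assume "h \<in> B n \<union> {g \<otimes> t | g t. g \<in> B n \<and> t \<in> S}"
  then consider "h \<in> B n" | g t where "h = g \<otimes> t" "g \<in> B n" "t \<in> S" by blast
  then show "h \<in> B (Suc n)"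
  proof cases
    case 1
    then show ?thesis by (auto simp: word_ball_eq)
  next
    case 2
    then obtain w where w: "w \<in> lists S" "length w \<le> n" "g = foldr (\<otimes>) w \<one>"
      by (auto simp: word_ball_eq)
    then have "h = foldr (\<otimes>) (w @ [t]) \<one>" using 2 foldr_snoc by simp
    moreover have "w @ [t] \<in> lists S" "length (w @ [t]) \<le> Suc n" using w 2 by auto
    ultimately show ?thesis unfolding word_ball_eq by blast
  qed
qed

lemma one_in_word_ball: "\<one> \<in> B n"
  unfolding word_ball_eq by (rule image_eqI[of _ _ "[]"]) auto

lemma word_ball_exhausts: "g \<in> carrier G \<Longrightarrow> \<exists>n. g \<in> B n"
  by (auto simp: word_ball_def)

abbreviation ball_join :: "'a set set \<Rightarrow> nat \<Rightarrow> 'a set set" where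
  "ball_join P n \<equiv> join_over M T (B n) P"

lemma meas_partition_ball_join: "meas_partition M P \<Longrightarrow> meas_partition M (ball_join P n)"
  by (rule meas_partition_join_over[OF _ finite_word_ball word_ball_carrier])

lemma finite_entropy_ball_join: "finite_entropy P \<Longrightarrow> finite_entropy (ball_join P n)"
  by (rule finite_entropy_join_over[OF _ finite_word_ball word_ball_carrier])

lemma atom_of_ball_join:
  "meas_partition M P \<Longrightarrow> x \<in> space M \<Longrightarrow>
    atom_of (ball_join P n) x = {y \<in> space M. \<forall>q\<in>B n. T q y \<in> atom_of P (T q x)}"
  by (rule atom_of_join_over[OF _ finite_word_ball word_ball_carrier])

text \<open>So the step from one ball to the next is an iterated splitting, once by each letter in \<open>S\<close>.\<close>

lemma atom_of_ball_join_Suc: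
  assumes P: "meas_partition M P" and x: "x \<in> space M"
  shows "atom_of (ball_join P (Suc n)) x = atom_of (ball_join P n) x \<inter> atom_of (join_over M T S (ball_join P n)) x"
proof -
  have t: "T t y \<in> space M" if "t \<in> S" "y \<in> space M" for t y
    using that T_space S_carrier by blast
  have comp: "T (q \<otimes> t) y = T q (T t y)" if "q \<in> B n" "t \<in> S" "y \<in> space M" for q t y
    using that T_mult word_ball_carrier S_carrier by blast
  have "atom_of (join_over M T S (ball_join P n)) x = {y \<in> space M. \<forall>t\<in>S. T t y \<in> atom_of (ball_join P n) (T t x)}"
    by (rule atom_of_join_over[OF meas_partition_ball_join[OF P] finite_S S_carrier x])
  also have "\<dots> = {y \<in> space M. \<forall>t\<in>S. \<forall>q\<in>B n. T (q \<otimes> t) y \<in> atom_of P (T (q \<otimes> t) x)}"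
    by (auto simp: atom_of_ball_join[OF P] t comp x)
  finally have "atom_of (join_over M T S (ball_join P n)) x
      = {y \<in> space M. \<forall>t\<in>S. \<forall>q\<in>B n. T (q \<otimes> t) y \<in> atom_of P (T (q \<otimes> t) x)}" .
  moreover have "(\<forall>q\<in>B (Suc n). R q) \<longleftrightarrow> (\<forall>q\<in>B n. R q) \<and> (\<forall>t\<in>S. \<forall>q\<in>B n. R (q \<otimes> t))" for R
    unfolding word_ball_Suc ball_Un by blast
  then have "atom_of (ball_join P (Suc n)) x = {y \<in> space M. (\<forall>q\<in>B n. T q y \<in> atom_of P (T q x)) \<and>
      (\<forall>t\<in>S. \<forall>q\<in>B n. T (q \<otimes> t) y \<in> atom_of P (T (q \<otimes> t) x))}"
    unfolding atom_of_ball_join[OF P x] by simp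
  ultimately show ?thesis
    using atom_of_ball_join[OF P x, of n] by auto
qed

lemma refines_ball_join_Suc: "meas_partition M P \<Longrightarrow> refines M (ball_join P (Suc n)) (ball_join P n)"
  by (simp add: refines_def atom_of_ball_join_Suc)

lemma refines_ball_join_shift:
  "meas_partition M P \<Longrightarrow> g \<in> B n \<Longrightarrow> refines M (ball_join P n) (shift g P)"
  using word_ball_carrier[of n] by (auto simp: refines_def atom_of_ball_join atom_of_shift)

text \<open>Allowing any \<open>X\<close> finer than \<open>ball_join P n\<close> makes it possible to enlarge the balls of two
  partitions independently of each other.\<close>

lemma F_real_ball_join_step:
  assumes X: "finite_entropy X" and P: "finite_entropy P" and ref: "refines M X (ball_join P n)"
    and Y: "meas_partition M Y"
    and eq: "\<And>x. x \<in> space M \<Longrightarrow> atom_of Y x = atom_of X x \<inter> atom_of (ball_join P (Suc n)) x"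
  shows "F_real Y \<le> F_real X"
proof -
  note m = finite_entropy_imp_meas_partition
  note J = meas_partition_join_over[OF meas_partition_ball_join[OF m[OF P]] finite_S S_carrier, of n]
  have "F_real Y = F_real (pjoin X (join_over M T S (ball_join P n)))"
  proof (rule F_real_cong[OF Y])
    show "meas_partition M (pjoin X (join_over M T S (ball_join P n)))"
      by (rule meas_partition_pjoin[OF m[OF X] J])
    fix x assume x: "x \<in> space M"
    have "atom_of X x \<subseteq> atom_of (ball_join P n) x" using ref x by (simp add: refines_def)
    then show "atom_of Y x = atom_of (pjoin X (join_over M T S (ball_join P n))) x"
      by (auto simp: eq[OF x] atom_of_pjoin[OF m[OF X] J x] atom_of_ball_join_Suc[OF m[OF P] x])
  qed
  also have "\<dots> \<le> F_real X"
    by (rule F_real_multiple_splitting_le[OF X finite_entropy_ball_join[OF P] ref finite_S]) simp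
  finally show ?thesis .
qed

lemma F_real_ball_join_decseq:
  assumes P: "finite_entropy P"
  shows "decseq (\<lambda>n. F_real (ball_join P n))"
proof (rule decseq_SucI)
  fix n
  note m = finite_entropy_imp_meas_partition[OF P]
  show "F_real (ball_join P (Suc n)) \<le> F_real (ball_join P n)"
    by (rule F_real_ball_join_step[OF finite_entropy_ball_join[OF P] P _ meas_partition_ball_join[OF m]])
      (auto simp: refines_def atom_of_ball_join_Suc[OF m])
qed

lemma
  assumes P: "finite_entropy P" and Q: "finite_entropy Q"
  shows F_real_pjoin_ball_join_decseq_left: "decseq (\<lambda>m. F_real (pjoin (ball_join P m) (ball_join Q n)))"
    and F_real_pjoin_ball_join_decseq_right: "decseq (\<lambda>n. F_real (pjoin (ball_join P m) (ball_join Q n)))"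
proof -
  note fm = finite_entropy_imp_meas_partition
  note [simp] = meas_partition_pjoin meas_partition_ball_join atom_of_pjoin[where M=M] fm[OF P] fm[OF Q]
  show "decseq (\<lambda>m. F_real (pjoin (ball_join P m) (ball_join Q n)))"
  proof (rule decseq_SucI)
    fix m show "F_real (pjoin (ball_join P (Suc m)) (ball_join Q n)) \<le> F_real (pjoin (ball_join P m) (ball_join Q n))"
      by (rule F_real_ball_join_step[OF finite_entropy_pjoin P, where n=m])
        (auto simp: refines_def atom_of_ball_join_Suc finite_entropy_ball_join P Q)
  qed
  show "decseq (\<lambda>n. F_real (pjoin (ball_join P m) (ball_join Q n)))"
  proof (rule decseq_SucI)
    fix n show "F_real (pjoin (ball_join P m) (ball_join Q (Suc n))) \<le> F_real (pjoin (ball_join P m) (ball_join Q n))"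
      by (rule F_real_ball_join_step[OF finite_entropy_pjoin Q, where n=n])
        (auto simp: refines_def atom_of_ball_join_Suc finite_entropy_ball_join P Q)
  qed
qed

section \<open>The invariant algebra as a limit\<close>

lemma
  assumes P: "meas_partition M P"
  shows partition_in_inv_algebra: "P \<subseteq> sets (inv_algebra G M T P)"
    and inv_algebra_invariant: "A \<in> sets (inv_algebra G M T P) \<Longrightarrow> g \<in> carrier G \<Longrightarrow>
      T g -` A \<inter> space M \<in> sets (inv_algebra G M T P)"
    and inv_algebra_least: "sigma_algebra (space M) \<Sigma> \<Longrightarrow> P \<subseteq> \<Sigma> \<Longrightarrow> invariant_sets G M T \<Sigma> \<Longrightarrow>
      sets (inv_algebra G M T P) \<subseteq> \<Sigma>"
proof -
  have "P \<subseteq> Pow (space M)" using meas_partition_cell[OF P] by blast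
  note eq = sets_inv_algebra[OF this]
  show "P \<subseteq> sets (inv_algebra G M T P)" unfolding eq by blast
  show "A \<in> sets (inv_algebra G M T P) \<Longrightarrow> g \<in> carrier G \<Longrightarrow>
      T g -` A \<inter> space M \<in> sets (inv_algebra G M T P)"
    unfolding eq invariant_sets_def by blast
  show "sigma_algebra (space M) \<Sigma> \<Longrightarrow> P \<subseteq> \<Sigma> \<Longrightarrow> invariant_sets G M T \<Sigma> \<Longrightarrow>
      sets (inv_algebra G M T P) \<subseteq> \<Sigma>"
    unfolding eq by blast
qed

lemma shift_in_inv_algebra:
  assumes P: "meas_partition M P" and "Q \<subseteq> sets (inv_algebra G M T P)" "g \<in> carrier G"
  shows "shift g Q \<subseteq> sets (inv_algebra G M T P)"
  using assms inv_algebra_invariant[OF P] by (auto simp: pullback_def)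

lemma pjoin_in_inv_algebra:
  "Q \<subseteq> sets (inv_algebra G M T P) \<Longrightarrow> R \<subseteq> sets (inv_algebra G M T P) \<Longrightarrow>
    pjoin Q R \<subseteq> sets (inv_algebra G M T P)"
  by (auto simp: pjoin_def)

lemma ball_join_in_inv_algebra:
  assumes P: "meas_partition M P"
  shows "ball_join P n \<subseteq> sets (inv_algebra G M T P)"
proof
  let ?K = "inv_algebra G M T P"
  fix A assume "A \<in> ball_join P n"
  then obtain C where C: "\<forall>q\<in>B n. C q \<in> shift q P" "A = space M \<inter> (\<Inter>q\<in>B n. C q)"
    by (auto simp: join_over_def)
  have "C q \<in> sets ?K" if "q \<in> B n" for q
    using shift_in_inv_algebra[OF P partition_in_inv_algebra[OF P], of q] C(1) that word_ball_carrier by blast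
  then have "(\<Inter>q\<in>B n. C q) \<in> sets ?K"
    using one_in_word_ball finite_word_ball by (intro sets.finite_INT) auto
  moreover have "space M \<in> sets ?K"
    using subalgebra_inv_algebra[OF mp P] by (metis sets.top subalgebra_def)
  ultimately show "A \<in> sets ?K" using C(2) by auto
qed

text \<open>The sets generated by all preimages \<open>T g -` A\<close> with \<open>A\<close> in \<open>P\<close> already form an invariant
  \<open>\<sigma>\<close>-algebra, so it suffices that each \<open>shift g P\<close> is seen by some \<open>Q n\<close>. The partitions \<open>Q n\<close> are left
  arbitrary because two sequences are needed: \<open>ball_join P n\<close> and its join with a shift of itself.\<close>

lemma sets_inv_algebra_exhaustion:
  assumes P: "meas_partition M P"
    and Q: "\<And>n. meas_partition M (Q n)" "\<And>n. Q n \<subseteq> sets (inv_algebra G M T P)"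
    and ex: "\<And>g. g \<in> carrier G \<Longrightarrow> \<exists>n. refines M (Q n) (shift g P)"
  shows "sets (inv_algebra G M T P) = sigma_sets (space M) (\<Union>n. sigma_sets (space M) (Q n))"
proof
  let ?K = "inv_algebra G M T P"
  let ?U = "\<Union>n. sigma_sets (space M) (Q n)"
  let ?gen = "\<Union>g\<in>carrier G. shift g P"
  have genP: "?gen \<subseteq> Pow (space M)"
    by (auto simp: pullback_def)
  have sp: "space ?K = space M"
    using subalgebra_inv_algebra[OF mp P] by (simp add: subalgebra_def)
  have "sigma_sets (space M) (Q n) \<subseteq> sets ?K" for n
    using sets.sigma_sets_subset[OF Q(2)] sp by simp
  then show "sigma_sets (space M) ?U \<subseteq> sets ?K"
    using sets.sigma_sets_subset[of ?U ?K] sp by auto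
  have "sets ?K \<subseteq> sigma_sets (space M) ?gen"
  proof (rule inv_algebra_least[OF P sigma_algebra_sigma_sets[OF genP]])
    show "P \<subseteq> sigma_sets (space M) ?gen"
    proof
      fix A assume A: "A \<in> P"
      then have "A = T \<one> -` A \<inter> space M"
        using meas_partition_cell(2)[OF P A] T_one by auto
      then have "A \<in> shift \<one> P" using A by (auto simp: pullback_def)
      then show "A \<in> sigma_sets (space M) ?gen" by (intro sigma_sets.Basic) auto
    qed
    show "invariant_sets G M T (sigma_sets (space M) ?gen)"
      unfolding invariant_sets_def
    proof (intro ballI)
      fix A g assume A: "A \<in> sigma_sets (space M) ?gen" and g: "g \<in> carrier G"
      have "T g \<in> measurable (sigma (space M) ?gen) (sigma (space M) ?gen)"
      proof (rule measurable_measure_of[OF genP])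
        show "T g \<in> space (sigma (space M) ?gen) \<rightarrow> space M"
          using T_space[OF g] by (auto simp: space_measure_of_conv)
        fix D assume "D \<in> ?gen"
        then obtain h C where h: "h \<in> carrier G" "C \<in> P" "D = T h -` C \<inter> space M"
          by (auto simp: pullback_def)
        have "T g -` D \<inter> space M = T (h \<otimes> g) -` C \<inter> space M"
          using h g T_mult T_space by auto
        then have "T g -` D \<inter> space M \<in> ?gen"
          using h g by (auto simp: pullback_def)
        then show "T g -` D \<inter> space (sigma (space M) ?gen) \<in> sets (sigma (space M) ?gen)"
          using genP by (simp add: space_measure_of_conv)
      qed
      from measurable_sets[OF this, of A] A genP
      show "T g -` A \<inter> space M \<in> sigma_sets (space M) ?gen"
        by (simp add: space_measure_of_conv)
    qed
  qed
  also have "\<dots> \<subseteq> sigma_sets (space M) ?U"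
  proof (rule sigma_sets_mono, safe)
    fix g A assume g: "g \<in> carrier G" and A: "A \<in> shift g P"
    obtain n where "refines M (Q n) (shift g P)" using ex[OF g] by blast
    from refines_imp_sigma_sets[OF Q(1) meas_partition_shift[OF P g] this] A
    show "A \<in> sigma_sets (space M) ?U" by (intro sigma_sets.Basic) auto
  qed
  finally show "sets ?K \<subseteq> sigma_sets (space M) ?U" .
qed

section \<open>The addition formula\<close>

definition F_cond_real :: "'a set set \<Rightarrow> 'a measure \<Rightarrow> real" where
  "F_cond_real P K = (1 - 2 * real r) * enn2real (cond_entropy M P K) +
     (\<Sum>i = 1..r. enn2real (cond_entropy M (pjoin P (shift (s i) P)) K))"

lemma F_cond_eq_F_cond_real:
  assumes P: "finite_entropy P" and K: "subalgebra M K"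
  shows "F_cond M r s T P K = ereal (F_cond_real P K)"
proof -
  have fin: "enn2ereal (cond_entropy M R K) = ereal (enn2real (cond_entropy M R K))"
    if "finite_entropy R" for R
  proof -
    have "cond_entropy M R K < \<infinity>"
      using that cond_entropy_le_entropy[OF _ K, of R] by (auto simp: finite_entropy_def)
    then show ?thesis
      by (cases "cond_entropy M R K") (auto simp: enn2ereal_ennreal)
  qed
  have "(\<Sum>i = 1..r. enn2ereal (cond_entropy M (pjoin P (shift (s i) P)) K))
      = (\<Sum>i = 1..r. ereal (enn2real (cond_entropy M (pjoin P (shift (s i) P)) K)))"
    by (intro sum.cong fin finite_entropy_pjoin finite_entropy_shift P s_carrier) auto
  then show ?thesis
    by (simp add: F_cond_def F_cond_real_def fin[OF P])
qed

text \<open>Grouping the terms of the difference expresses it by conditional entropies of \<open>Q\<close> and of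
  \<open>pjoin Q (shift (s i) Q)\<close> given partitions that increase to the invariant algebra of \<open>P\<close>.\<close>

lemma F_real_increment_convergence:
  assumes P: "finite_entropy P" and Q: "finite_entropy Q"
  shows "(\<lambda>n. F_real (pjoin (ball_join P n) Q) - F_real (ball_join P n)) \<longlonglongrightarrow> F_cond_real Q (inv_algebra G M T P)"
proof -
  note fm = finite_entropy_imp_meas_partition
  let ?K = "inv_algebra G M T P"
  let ?J = "\<lambda>i n. pjoin (ball_join P n) (shift (s i) (ball_join P n))"
  have K: "subalgebra M ?K" by (rule subalgebra_inv_algebra[OF mp fm[OF P]])
  have ex: "\<exists>n. refines M (ball_join P n) (shift g P)" if "g \<in> carrier G" for g
    using word_ball_exhausts[OF that] refines_ball_join_shift[OF fm[OF P]] by blast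
  have 1: "(\<lambda>n. real_entropy (pjoin Q (ball_join P n)) - real_entropy (ball_join P n)) \<longlonglongrightarrow> enn2real (cond_entropy M Q ?K)"
    by (intro real_entropy_conditional_convergence Q finite_entropy_ball_join P refines_ball_join_Suc fm K
        sets_inv_algebra_exhaustion meas_partition_ball_join ball_join_in_inv_algebra ex)
  have 2: "(\<lambda>n. real_entropy (pjoin (pjoin Q (shift (s i) Q)) (?J i n)) - real_entropy (?J i n))
      \<longlonglongrightarrow> enn2real (cond_entropy M (pjoin Q (shift (s i) Q)) ?K)" if i: "i \<in> {1..r}" for i
  proof (rule real_entropy_conditional_convergence)
    note si = s_carrier[OF i]
    note parts = meas_partition_pjoin meas_partition_shift meas_partition_ball_join fm[OF P]
    show "finite_entropy (pjoin Q (shift (s i) Q))" "finite_entropy (?J i n)" for n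
      by (intro finite_entropy_pjoin finite_entropy_shift finite_entropy_ball_join P Q si)+
    show "refines M (?J i (Suc n)) (?J i n)" for n
      by (auto simp: refines_def atom_of_pjoin[where M=M] atom_of_shift parts si T_space atom_of_ball_join_Suc[OF fm[OF P]])
    show "sets ?K = sigma_sets (space M) (\<Union>n. sigma_sets (space M) (?J i n))"
    proof (rule sets_inv_algebra_exhaustion)
      show "?J i n \<subseteq> sets ?K" for n
        by (intro pjoin_in_inv_algebra shift_in_inv_algebra ball_join_in_inv_algebra fm P si)
      fix g assume "g \<in> carrier G"
      from ex[OF this] obtain n where "refines M (ball_join P n) (shift g P)" by blast
      then have "refines M (?J i n) (shift g P)"
        by (auto simp: refines_def atom_of_pjoin[where M=M] parts si)
      then show "\<exists>n. refines M (?J i n) (shift g P)" by blast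
    qed (simp_all add: parts si)
  qed (rule K)
  have "F_real (pjoin (ball_join P n) Q) - F_real (ball_join P n) =
      (1 - 2 * real r) * (real_entropy (pjoin Q (ball_join P n)) - real_entropy (ball_join P n)) +
      (\<Sum>i = 1..r. real_entropy (pjoin (pjoin Q (shift (s i) Q)) (?J i n)) - real_entropy (?J i n))" for n
  proof -
    note parts = meas_partition_pjoin meas_partition_shift meas_partition_ball_join fm[OF P] fm[OF Q]
    let ?X = "pjoin (ball_join P n) Q"
    have "real_entropy ?X = real_entropy (pjoin Q (ball_join P n))"
      by (rule real_entropy_cong) (auto simp: parts atom_of_pjoin[where M=M])
    moreover have "real_entropy (pjoin ?X (shift (s i) ?X)) = real_entropy (pjoin (pjoin Q (shift (s i) Q)) (?J i n))"
      if "i \<in> {1..r}" for i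
      using s_carrier[OF that]
      by (intro real_entropy_cong) (auto simp: parts atom_of_pjoin[where M=M] atom_of_shift T_space)
    ultimately show ?thesis
      by (simp add: F_real_def sum_subtractf algebra_simps)
  qed
  then show ?thesis
    unfolding F_cond_real_def by (auto intro!: tendsto_intros 1 2)
qed

end

lemma INF_positive_decseq:
  fixes f :: "nat \<Rightarrow> ereal"
  assumes "decseq f"
  shows "(INF n\<in>{0<..}. f n) = (INF n. f n)"
proof (rule antisym)
  show "(INF n\<in>{0<..}. f n) \<le> (INF n. f n)"
  proof (rule INF_greatest)
    fix n :: nat
    have "(INF n\<in>{0<..}. f n) \<le> f (Suc n)" by (rule INF_lower) simp
    also have "\<dots> \<le> f n" using assms by (simp add: decseq_Suc_iff)
    finally show "(INF n\<in>{0<..}. f n) \<le> f n" .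
  qed
qed (rule INF_superset_mono, auto)

text \<open>By monotonicity the diagonal infimum is the iterated one, with \<open>n\<close> first. For fixed \<open>m\<close> the row
  \<open>g n m = a n + (g n m - a n)\<close> converges to the infimum of \<open>a\<close>, possibly \<open>- \<infinity>\<close>, plus the finite number
  \<open>L m\<close>. Infima are computed as limits because sums of limits also make sense when one of them is
  \<open>- \<infinity>\<close>.\<close>

lemma INF_diagonal_eq_sum:
  fixes a L :: "nat \<Rightarrow> real" and g :: "nat \<Rightarrow> nat \<Rightarrow> real"
  assumes a: "decseq a" and g: "\<And>m. decseq (\<lambda>n. g n m)" "\<And>n. decseq (\<lambda>m. g n m)"
    and lim: "\<And>m. (\<lambda>n. g n m - a n) \<longlonglongrightarrow> L m"
  shows "(INF n\<in>{0<..}. ereal (g n n)) = (INF n\<in>{0<..}. ereal (a n)) + (INF m\<in>{0<..}. ereal (L m))"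
proof -
  have L: "decseq L"
  proof (rule decseq_SucI)
    fix m
    show "L (Suc m) \<le> L m"
      by (rule LIMSEQ_le[OF lim lim]) (use g(2) in \<open>auto simp: decseq_Suc_iff\<close>)
  qed
  have diag: "decseq (\<lambda>n. ereal (g n n))"
  proof (rule decseq_SucI)
    fix n
    have "g (Suc n) (Suc n) \<le> g n (Suc n)" using g(1) by (simp add: decseq_Suc_iff)
    also have "\<dots> \<le> g n n" using g(2) by (simp add: decseq_Suc_iff)
    finally show "ereal (g (Suc n) (Suc n)) \<le> ereal (g n n)" by simp
  qed
  have ea: "decseq (\<lambda>n. ereal (a n))" and eL: "decseq (\<lambda>n. ereal (L n))"
    and eg: "decseq (\<lambda>n. ereal (g n m))" for m
    using a L g(1) by (simp_all add: decseq_def)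
  define A where "A = (INF n. ereal (a n))"
  have A: "A \<le> ereal (a 0)" unfolding A_def by (rule INF_lower) simp
  have row: "(INF n. ereal (g n m)) = A + ereal (L m)" for m
  proof (rule LIMSEQ_unique)
    show "(\<lambda>n. ereal (g n m)) \<longlonglongrightarrow> (INF n. ereal (g n m))" by (rule LIMSEQ_INF[OF eg])
    have "(\<lambda>n. ereal (a n) + ereal (g n m - a n)) \<longlonglongrightarrow> A + ereal (L m)"
      unfolding A_def by (intro tendsto_add_ereal_general1 LIMSEQ_INF ea tendsto_ereal lim) simp
    then show "(\<lambda>n. ereal (g n m)) \<longlonglongrightarrow> A + ereal (L m)" by simp
  qed
  have "(INF n. ereal (g n n)) = (INF m. INF n. ereal (g n m))"
  proof (rule antisym)
    show "(INF n. ereal (g n n)) \<le> (INF m. INF n. ereal (g n m))"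
    proof (intro INF_greatest)
      fix m n :: nat
      let ?k = "max m n"
      have "(INF n. ereal (g n n)) \<le> ereal (g ?k ?k)" by (rule INF_lower) simp
      also have "\<dots> \<le> ereal (g n ?k)" using g(1)[of ?k] by (simp add: decseq_def)
      also have "\<dots> \<le> ereal (g n m)" using g(2)[of n] by (simp add: decseq_def)
      finally show "(INF n. ereal (g n n)) \<le> ereal (g n m)" .
    qed
    show "(INF m. INF n. ereal (g n m)) \<le> (INF n. ereal (g n n))"
      by (intro INF_greatest INF_lower2[of _ UNIV] order_refl) auto
  qed
  also have "\<dots> = (INF m. A + ereal (L m))" by (simp add: row)
  also have "\<dots> = A + (INF m. ereal (L m))"
  proof (rule LIMSEQ_unique)
    have "decseq (\<lambda>m. A + ereal (L m))"
      using eL by (auto simp: decseq_def intro!: add_left_mono)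
    then show "(\<lambda>m. A + ereal (L m)) \<longlonglongrightarrow> (INF m. A + ereal (L m))" by (rule LIMSEQ_INF)
    have "(INF m. ereal (L m)) \<le> ereal (L 0)" by (rule INF_lower) simp
    then show "(\<lambda>m. A + ereal (L m)) \<longlonglongrightarrow> A + (INF m. ereal (L m))"
      using A by (intro tendsto_add_ereal_general tendsto_const LIMSEQ_INF eL) auto
  qed
  finally show ?thesis
    unfolding INF_positive_decseq[OF diag] INF_positive_decseq[OF ea] INF_positive_decseq[OF eL] A_def .
qed

theorem (in generated_action) f_inv_pjoin:
  assumes P: "finite_entropy P" and Q: "finite_entropy Q"
  shows "f_inv G S M r s T (pjoin P Q) =
    f_inv G S M r s T P + f_cond G S M r s T Q (inv_algebra G M T P)"
proof -
  note fm = finite_entropy_imp_meas_partition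
  have join: "F_real (ball_join (pjoin P Q) n) = F_real (pjoin (ball_join P n) (ball_join Q n))" for n
  proof (rule F_real_cong)
    fix x assume x: "x \<in> space M"
    have "T q x \<in> space M" if "q \<in> B n" for q
      using that word_ball_carrier T_space x by blast
    then show "atom_of (ball_join (pjoin P Q) n) x = atom_of (pjoin (ball_join P n) (ball_join Q n)) x"
      using x by (auto simp: atom_of_ball_join meas_partition_pjoin meas_partition_ball_join fm P Q atom_of_pjoin[where M=M])
  qed (simp_all add: meas_partition_pjoin meas_partition_ball_join fm P Q)
  have "f_inv G S M r s T (pjoin P Q) = (INF n\<in>{0<..}. ereal (F_real (pjoin (ball_join P n) (ball_join Q n))))"
    by (simp add: f_inv_def F_fun_eq_F_real finite_entropy_ball_join finite_entropy_pjoin P Q join)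
  also have "\<dots> = (INF n\<in>{0<..}. ereal (F_real (ball_join P n))) +
      (INF n\<in>{0<..}. ereal (F_cond_real (ball_join Q n) (inv_algebra G M T P)))"
    by (rule INF_diagonal_eq_sum)
      (intro F_real_ball_join_decseq F_real_pjoin_ball_join_decseq_left F_real_pjoin_ball_join_decseq_right
        F_real_increment_convergence finite_entropy_ball_join P Q)+
  also have "(INF n\<in>{0<..}. ereal (F_real (ball_join P n))) = f_inv G S M r s T P"
    by (simp add: f_inv_def F_fun_eq_F_real finite_entropy_ball_join P)
  also have "(INF n\<in>{0<..}. ereal (F_cond_real (ball_join Q n) (inv_algebra G M T P)))
      = f_cond G S M r s T Q (inv_algebra G M T P)"
    by (simp add: f_cond_def F_cond_eq_F_cond_real finite_entropy_ball_join Q subalgebra_inv_algebra[OF mp fm[OF P]])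
  finally show ?thesis .
qed

lemma standard_prob_space_imp_prob_space:
  assumes "standard_prob_space M"
  shows "prob_space M"
proof -
  obtain N where N: "prob_space N" "M = N \<or> M = completion N"
    using assms by (auto simp: standard_prob_space_def)
  have "prob_space (completion N)"
    using prob_space.emeasure_space_1[OF N(1)]
    by (intro prob_spaceI) (simp add: emeasure_completion)
  with N show ?thesis by auto
qed

lemma generated_action_free_group:
  fixes G :: "('g, 'm) monoid_scheme"
  assumes G: "free_group_on G r s" and S: "S = s ` {1..r} \<union> (\<lambda>i. inv\<^bsub>G\<^esub> (s i)) ` {1..r}"
    and mp: "mp_action G M T"
  shows "generated_action M G r s S T"
proof -
  have grp: "group G" and sG: "s ` {1..r} \<subseteq> carrier G"
    and bij: "bij_betw (\<lambda>w. foldr (\<otimes>\<^bsub>G\<^esub>) (map (letter G s) w) \<one>\<^bsub>G\<^esub>)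
       {w \<in> lists ({1..r} \<times> UNIV). reduced_word w} (carrier G)"
    using G unfolding free_group_on_def by blast+
  interpret group G by (rule grp)
  interpret prob_space M
    by (rule standard_prob_space_imp_prob_space) (use mp in \<open>simp add: mp_action_def\<close>)
  have "\<exists>w\<in>lists S. foldr (\<otimes>\<^bsub>G\<^esub>) w \<one>\<^bsub>G\<^esub> = g" if "g \<in> carrier G" for g
  proof -
    have "g \<in> (\<lambda>w. foldr (\<otimes>\<^bsub>G\<^esub>) (map (letter G s) w) \<one>\<^bsub>G\<^esub>) `
        {w \<in> lists ({1..r} \<times> UNIV). reduced_word w}"
      unfolding bij_betw_imp_surj_on[OF bij] by (rule that)
    then obtain w where w: "w \<in> lists ({1..r} \<times> UNIV)" "g = foldr (\<otimes>\<^bsub>G\<^esub>) (map (letter G s) w) \<one>\<^bsub>G\<^esub>"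
      by (elim imageE CollectE conjE)
    have "letter G s p \<in> S" if "p \<in> {1..r} \<times> UNIV" for p
      using that by (cases p, cases "snd p") (simp_all add: letter_def S)
    then have "map (letter G s) w \<in> lists S"
      using w(1) unfolding in_lists_conv_set set_map by blast
    with w(2) show ?thesis by blast
  qed
  note generates = this
  show ?thesis
  proof unfold_locales
    show "finite S" by (simp add: S)
    show "S \<subseteq> carrier G" using sG by (auto simp: S)
    show "\<exists>w\<in>lists S. foldr (\<otimes>\<^bsub>G\<^esub>) w \<one>\<^bsub>G\<^esub> = g" if "g \<in> carrier G" for g
      by (rule generates[OF that])
    show "s i \<in> S" if "i \<in> {1..r}" for i using that by (simp add: S)
    fix t assume "t \<in> S"
    then consider i where "i \<in> {1..r}" "t = s i" | i where "i \<in> {1..r}" "t = inv\<^bsub>G\<^esub> (s i)"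
      unfolding S by blast
    then show "\<exists>i\<in>{1..r}. t = s i \<or> t \<otimes>\<^bsub>G\<^esub> s i = \<one>\<^bsub>G\<^esub>"
    proof cases
      case 1
      then show ?thesis by blast
    next
      case 2
      then have "s i \<in> carrier G" using sG by blast
      then have "t \<otimes>\<^bsub>G\<^esub> s i = \<one>\<^bsub>G\<^esub>" by (simp add: 2)
      with 2(1) show ?thesis by blast
    qed
  qed (rule mp)
qed

lemma generated_action_free_monoid:
  fixes G :: "('g, 'm) monoid_scheme"
  assumes G: "free_monoid_on G r s" and S: "S = s ` {1..r}" and mp: "mp_action G M T"
  shows "generated_action M G r s S T"
proof -
  have mon: "monoid G" and sG: "s ` {1..r} \<subseteq> carrier G"
    and bij: "bij_betw (\<lambda>w. foldr (\<otimes>\<^bsub>G\<^esub>) (map s w) \<one>\<^bsub>G\<^esub>) (lists {1..r}) (carrier G)"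
    using G unfolding free_monoid_on_def by blast+
  interpret monoid G by (rule mon)
  interpret prob_space M
    by (rule standard_prob_space_imp_prob_space) (use mp in \<open>simp add: mp_action_def\<close>)
  have "\<exists>w\<in>lists S. foldr (\<otimes>\<^bsub>G\<^esub>) w \<one>\<^bsub>G\<^esub> = g" if "g \<in> carrier G" for g
  proof -
    have "g \<in> (\<lambda>w. foldr (\<otimes>\<^bsub>G\<^esub>) (map s w) \<one>\<^bsub>G\<^esub>) ` lists {1..r}"
      unfolding bij_betw_imp_surj_on[OF bij] by (rule that)
    then obtain w where w: "w \<in> lists {1..r}" "g = foldr (\<otimes>\<^bsub>G\<^esub>) (map s w) \<one>\<^bsub>G\<^esub>"
      by (elim imageE)
    have "map s w \<in> lists S"
      using w(1) unfolding in_lists_conv_set set_map S by blast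
    with w(2) show ?thesis by blast
  qed
  note generates = this
  show ?thesis
  proof unfold_locales
    show "finite S" by (simp add: S)
    show "S \<subseteq> carrier G" using sG by (simp add: S)
    show "\<exists>w\<in>lists S. foldr (\<otimes>\<^bsub>G\<^esub>) w \<one>\<^bsub>G\<^esub> = g" if "g \<in> carrier G" for g
      by (rule generates[OF that])
    show "s i \<in> S" if "i \<in> {1..r}" for i using that by (simp add: S)
    show "\<exists>i\<in>{1..r}. t = s i \<or> t \<otimes>\<^bsub>G\<^esub> s i = \<one>\<^bsub>G\<^esub>" if "t \<in> S" for t
      using that unfolding S by blast
  qed (rule mp)
qed

theorem theorem1p3:
  fixes G :: "('g, 'm) monoid_scheme"
    and s :: "nat \<Rightarrow> 'g" and r :: nat and S :: "'g set"
    and M :: "'a measure" and T :: "'g \<Rightarrow> 'a \<Rightarrow> 'a"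
    and \<alpha> \<beta> :: "'a set set"
  assumes "free_group_on G r s \<and> S = s ` {1..r} \<union> (\<lambda>i. inv\<^bsub>G\<^esub> (s i)) ` {1..r}
           \<or> free_monoid_on G r s \<and> S = s ` {1..r}"
    and "mp_action G M T"
    and "meas_partition M \<alpha>" and "meas_partition M \<beta>"
    and "entropy M \<alpha> + entropy M \<beta> < \<infinity>"
  shows "f_inv G S M r s T (pjoin \<alpha> \<beta>) =
         f_inv G S M r s T \<alpha> + f_cond G S M r s T \<beta> (inv_algebra G M T \<alpha>)"
proof -
  from assms(1) have "generated_action M G r s S T"
    by (elim disjE conjE)
      (rule generated_action_free_group[OF _ _ assms(2)] generated_action_free_monoid[OF _ _ assms(2)], assumption+)+
  then interpret generated_action M G r s S T .
  have "finite_entropy \<alpha>" "finite_entropy \<beta>"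
    using assms(3-5) by (auto simp: finite_entropy_def)
  then show ?thesis by (rule f_inv_pjoin)
qed

end
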